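(* Let $f:\mathbb{R}^n\to\mathbb{R}\cup\{+\infty\}$ and $g:\mathbb{R}^m\to\mathbb{R}\cup\{+\infty\}$ be closed proper convex functions and let $M$ be an $m\times n$ real matrix. Consider the primal problem $\min_{x\in\mathbb{R}^n}\{f(x)+g(Mx)\}$ and the dual problem $\min_{p\in\mathbb{R}^m}\{f^*(-M^\top p)+g^*(p)\}$. Let $W$ be a symmetric positive definite $m\times m$ matrix, let $\{\delta_x^k\}_{k=0}^\infty$ be a summable sequence of nonnegative reals, let $\{d_z^k\}_{k=0}^\infty\subset\mathbb{R}^m$ satisfy $\sum_{k=0}^\infty\|d_z^k\|<\infty$, and let $\{\nu_k\}_{k=0}^\infty\subset\mathbb{R}$ satisfy $\inf_k\nu_k>0$ and $\sup_k\nu_k<2$. For a constant scalar $c>0$ and arbitrary initial $z^0,p^0\in\mathbb{R}^m$, suppose that the sequences $\{z^k\}_{k=0}^\infty,\{p^k\}_{k=0}^\infty\subset\mathbb{R}^m$ and $\{x^k\}_{k=1}^\infty,\{\dot x^k\}_{k=1}^\infty\subset\mathbb{R}^n$ satisfy the following for all $k\ge0$: $$\|Mx^{k+1}-M\dot x^{k+1}\|\le\delta_x^k,\quad\text{where}\quad \dot x^{k+1}\in\operatorname*{arg\,min}_{x\in\mathbb{R}^n}\Big\{f(x)+\langle p^k,Mx\rangle+\frac c2\|Mx-z^k\|_W^2\Big\},$$ $$z^{k+1}=\operatorname*{arg\,min}_{z\in\mathbb{R}^m}\Big\{g(z)-\langle p^k,z\rangle+\frac c2\|\nu_kMx^{k+1}+(1-\nu_k)z^k-z\|_W^2\Big\}+d_z^k,$$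 $$p^{k+1}=p^k+cW\big(\nu_kMx^{k+1}+(1-\nu_k)z^k-z^{k+1}\big).$$ If strong duality holds for $f$, $g$, and $M$, then $\{p^k\}$ converges to a solution $p^*$ of the dual problem, while $\{z^k\}$ and $\{Mx^k\}$ converge to some $z^*\in\partial g^*(p^* )$ such that $-z^*\in\partial\big(f^*\circ(-M^\top)\big)(p^* )$. If the regularity condition $\operatorname{ri}\operatorname{im}\partial f\cap\operatorname{im}M^\top\neq\emptyset$ also holds, then $z^*=Mx^*$, where $x^*$ is some solution of the primal problem. If the dual problem has no solution but there exists some $\bar p\in\mathbb{R}^m$ at which the dual objective $f^*(-M^\top p)+g^*(p)$ is finite, then at least one of the sequences $\{p^k\}$ or $\{z^k\}$ must be unbounded.
   Context: $\|u\|_W=\sqrt{u^\top Wu}$; $\|\cdot\|$ is the Euclidean norm; $f^*,g^*$ are convex conjugates; $f^*\circ(-M^\top)$ is the function $p\mapsto f^*(-M^\top p)$; $\partial$ is the convex subdifferential; $\operatorname{im}\partial f=\bigcup_{x}\partial f(x)$; $\operatorname{im}M^\top$ is the range of $M^\top$; $\operatorname{ri}$ is the relative interior (interior relative to the affine hull). "Strong duality holds for $f$, $g$, $M$" means that there exist $x^*\in\mathbb{R}^n$ and $p^*\in\mathbb{R}^m$ such that $\big(f(x^* )+g(Mx^* )\big)+\big(f^*(-M^\top p^* )+g^*(p^* )\big)=0$; equivalently $-M^\top p^*\in\partial f(x^* )$ and $p^*\in\partial g(Mx^* )$. *)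

theory Defs
  imports "HOL-Analysis.Analysis"
begin

definition ereal_epigraph :: "('a \<Rightarrow> ereal) \<Rightarrow> ('a \<times> real) set" where
  "ereal_epigraph f = {(x, r). f x \<le> ereal r}"

definition closed_proper_convex :: "('a::euclidean_space \<Rightarrow> ereal) \<Rightarrow> bool" where
  "closed_proper_convex f \<longleftrightarrow>
     (\<forall>x. f x \<noteq> -\<infinity>) \<and> (\<exists>x. f x \<noteq> \<infinity>) \<and>
     convex (ereal_epigraph f) \<and> closed (ereal_epigraph f)"

definition convex_conjugate :: "('a::euclidean_space \<Rightarrow> ereal) \<Rightarrow> 'a \<Rightarrow> ereal" where
  "convex_conjugate f y = (SUP x. ereal (y \<bullet> x) - f x)"

text \<open>For proper \<open>f\<close> the subdifferential is empty at every \<open>x\<close> with \<open>f x = \<infinity>\<close>,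
  so no separate domain condition is needed.\<close>

definition subdifferential :: "('a::euclidean_space \<Rightarrow> ereal) \<Rightarrow> 'a \<Rightarrow> 'a set" where
  "subdifferential f x = {v. \<forall>y. f x + ereal (v \<bullet> (y - x)) \<le> f y}"

definition symmetric_pos_def :: "real^'m^'m \<Rightarrow> bool" where
  "symmetric_pos_def W \<longleftrightarrow> transpose W = W \<and> (\<forall>u. u \<noteq> 0 \<longrightarrow> u \<bullet> (W *v u) > 0)"

definition weighted_norm :: "real^'m^'m \<Rightarrow> real^'m \<Rightarrow> real" where
  "weighted_norm W u = sqrt (u \<bullet> (W *v u))"

definition minimizes :: "('a \<Rightarrow> ereal) \<Rightarrow> 'a \<Rightarrow> bool" where
  "minimizes h x \<longleftrightarrow> is_arg_min h (\<lambda>_. True) x"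

definition primal_objective ::
    "(real^'n \<Rightarrow> ereal) \<Rightarrow> (real^'m \<Rightarrow> ereal) \<Rightarrow> real^'n^'m \<Rightarrow> real^'n \<Rightarrow> ereal" where
  "primal_objective f g M x = f x + g (M *v x)"

definition dual_objective ::
    "(real^'n \<Rightarrow> ereal) \<Rightarrow> (real^'m \<Rightarrow> ereal) \<Rightarrow> real^'n^'m \<Rightarrow> real^'m \<Rightarrow> ereal" where
  "dual_objective f g M p = convex_conjugate f (- (transpose M *v p)) + convex_conjugate g p"

text \<open>For proper \<open>f\<close> and \<open>g\<close> none of the four terms is \<open>-\<infinity>\<close>, so a zero sum makes all
  of them finite; the convention \<open>\<infinity> + (-\<infinity>) = \<infinity>\<close> of \<^typ>\<open>ereal\<close> plays no role.\<close>

definition strong_duality ::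
    "(real^'n \<Rightarrow> ereal) \<Rightarrow> (real^'m \<Rightarrow> ereal) \<Rightarrow> real^'n^'m \<Rightarrow> bool" where
  "strong_duality f g M \<longleftrightarrow>
     (\<exists>x p. primal_objective f g M x + dual_objective f g M p = 0)"

end

(*
  With G = cW and P^k = G^{-1} p^k, optimality of the two subproblems says that, up to summable
  errors, S^k = P^k + z^k is an orbit of the relaxed Douglas-Rachford operator of
  A = \<partial>(f^* o (-M^T)) and B = \<partial>g^*, everything being measured in the inner product of G.
  If A + B has a zero, the distance of S^k to each fixed point is nonincreasing up to summable
  errors and the residuals tend to 0; cluster points are zeros because the graphs are closed, so
  the whole sequence converges.  Conversely, when the orbit is bounded, a cluster point of the
  averages of the S^k weighted by \<nu>_k is a fixed point, so the dual problem has a solution.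
  Under the relative interior condition, a subgradient of f^* restricted to im M^T extends to a
  subgradient of f^* (proper separation), which yields the primal solution.
*)

theory Submission
  imports Defs
begin

section \<open>Conjugates and subgradients\<close>

text \<open>The error in the z-step moves the pair of B to \<open>(P + d, z - d)\<close>, which has
  the same sum S. It therefore does not disturb S directly and enters the estimates only through
  inner products with \<open>d\<close>. When the orbit is bounded but no zero is known, the
  comparison point \<open>s\<close> has to be arbitrary. It is decomposed along B and then along A,
  and \<open>g\<close> is minus the displacement of \<open>s\<close> under the operator. Firm
  nonexpansiveness then leaves the drift <S^k - s, g> + |g|^2. Its \<nu>-weighted average is bounded
  by a telescoping quantity over the total weight; taking \<open>s\<close> to be a cluster point of
  the weighted averages makes the inner product vanish, so g = 0. Decomposing an arbitrary
  \<open>s\<close> is maximality of the two operators, obtained by minimizing a function plus a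
  quadratic. The regularity condition speaks of im \<partial>f, which may fail to be convex, whereas
  separation needs the domain of the conjugate. The two are reconciled because im \<partial>f lies
  between that domain and its relative interior.\<close>

lemma conjugate_ge: "ereal (y \<bullet> x) - f x \<le> convex_conjugate f y"
  unfolding convex_conjugate_def by (rule SUP_upper) simp

lemma conjugate_le_iff:
  assumes "\<And>x. f x \<noteq> -\<infinity>"
  shows "convex_conjugate f y \<le> ereal r \<longleftrightarrow> (\<forall>x. ereal (y \<bullet> x - r) \<le> f x)"
proof -
  have "ereal (y \<bullet> x) - f x \<le> ereal r \<longleftrightarrow> ereal (y \<bullet> x - r) \<le> f x" for x
    using assms[of x] by (cases "f x") auto
  then show ?thesis
    unfolding convex_conjugate_def by (simp add: SUP_le_iff)
qed

lemma conjugate_not_MInf: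
  assumes "f x \<noteq> \<infinity>"
  shows "convex_conjugate f y \<noteq> -\<infinity>"
  using conjugate_ge[of y x f] assms by (cases "f x") auto

text \<open>The epigraph of a conjugate is an intersection of closed halfspaces, one for each point
  where \<open>f\<close> is finite; composing with \<open>L\<close> puts the adjoint into their
  normals. The instances used are \<open>id\<close> and the map to -M^T q. Finiteness at one point
  gives properness.\<close>

lemma closed_proper_convex_conjugate_comp:
  fixes f :: "'a::euclidean_space \<Rightarrow> ereal" and L :: "'b::euclidean_space \<Rightarrow> 'a"
  assumes nm: "\<And>x. f x \<noteq> -\<infinity>" and pr: "f x0 \<noteq> \<infinity>"
    and L: "linear L" and fin: "convex_conjugate f (L q0) \<noteq> \<infinity>"
  shows "closed_proper_convex (convex_conjugate f \<circ> L)"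
proof -
  have epi: "ereal_epigraph (convex_conjugate f \<circ> L) =
      (\<Inter>x. {(q, r). ereal (L q \<bullet> x - r) \<le> f x})"
    unfolding ereal_epigraph_def using conjugate_le_iff[of f, OF nm] by auto
  have adj: "L q \<bullet> x = q \<bullet> adjoint L x" for q x
    using adjoint_works[OF L, of q x] by simp
  have half: "closed {(q, r). ereal (L q \<bullet> x - r) \<le> f x} \<and> convex {(q, r). ereal (L q \<bullet> x - r) \<le> f x}"
    for x
  proof (cases "f x")
    case (real b)
    have "{(q, r). ereal (L q \<bullet> x - r) \<le> f x} = {w. (adjoint L x, -1) \<bullet> w \<le> b}"
      using real by (auto simp: adj inner_commute[of "adjoint L x"])
    then show ?thesis
      by (simp add: closed_halfspace_le convex_halfspace_le)
  qed (use nm in auto)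
  show ?thesis
    unfolding closed_proper_convex_def
  proof (intro conjI)
    show "convex (ereal_epigraph (convex_conjugate f \<circ> L))"
      unfolding epi by (rule convex_INT) (use half in blast)
    show "closed (ereal_epigraph (convex_conjugate f \<circ> L))"
      unfolding epi by (rule closed_INT) (use half in blast)
  qed (use conjugate_not_MInf[of f, OF pr] fin in auto)
qed

lemma subdifferential_dom:
  assumes "v \<in> subdifferential h x" "h y \<noteq> \<infinity>"
  shows "h x \<noteq> \<infinity>"
proof
  assume "h x = \<infinity>"
  moreover have "h x + ereal (v \<bullet> (y - x)) \<le> h y"
    using assms by (simp add: subdifferential_def)
  ultimately show False
    using assms(2) by simp
qed

lemma subdifferential_monotone:
  assumes v: "v \<in> subdifferential h x" and w: "w \<in> subdifferential h y"
    and h: "closed_proper_convex h"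
  shows "0 \<le> (v - w) \<bullet> (x - y)"
proof -
  obtain u where u: "h u \<noteq> \<infinity>" and nm: "\<And>u. h u \<noteq> -\<infinity>"
    using h by (auto simp: closed_proper_convex_def)
  obtain a b where ab: "h x = ereal a" "h y = ereal b"
    using subdifferential_dom[OF v u] subdifferential_dom[OF w u] nm[of x] nm[of y]
    by (cases "h x"; cases "h y") auto
  have "h x + ereal (v \<bullet> (y - x)) \<le> h y" "h y + ereal (w \<bullet> (x - y)) \<le> h x"
    using v w by (auto simp: subdifferential_def)
  then show ?thesis
    by (simp add: ab inner_diff_left inner_diff_right)
qed

lemma closed_epigraph_limit:
  assumes h: "closed_proper_convex h"
    and x: "x \<longlonglongrightarrow> x'" and r: "r \<longlonglongrightarrow> r'" and le: "\<And>k::nat. h (x k) \<le> ereal (r k)"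
  shows "h x' \<le> ereal r'"
proof -
  have "closed (ereal_epigraph h)"
    using h by (simp add: closed_proper_convex_def)
  moreover have "(\<lambda>k. (x k, r k)) \<longlonglongrightarrow> (x', r')"
    by (intro tendsto_Pair x r)
  ultimately have "(x', r') \<in> ereal_epigraph h"
    using closed_sequentially[of "ereal_epigraph h" "\<lambda>k. (x k, r k)"] le
    by (auto simp: ereal_epigraph_def)
  then show ?thesis
    by (simp add: ereal_epigraph_def)
qed

text \<open>Lower semicontinuity acts through the epigraph: for a test point \<open>y\<close> with
  \<open>h y\<close> finite, the subgradient inequality bounds \<open>h (x k)\<close> from above, so
  it names a point of the closed epigraph, and these points converge.\<close>

lemma subdifferential_closed:
  assumes h: "closed_proper_convex h"
    and v: "v \<longlonglongrightarrow> v'" and x: "x \<longlonglongrightarrow> x'" and sub: "\<And>k::nat. v k \<in> subdifferential h (x k)"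
  shows "v' \<in> subdifferential h x'"
  unfolding subdifferential_def
proof (intro CollectI allI)
  fix y
  have nm: "\<And>u. h u \<noteq> -\<infinity>"
    using h by (auto simp: closed_proper_convex_def)
  show "h x' + ereal (v' \<bullet> (y - x')) \<le> h y"
  proof (cases "h y")
    case (real b)
    have "h (x k) \<le> ereal (b - v k \<bullet> (y - x k))" for k
    proof -
      have "h (x k) + ereal (v k \<bullet> (y - x k)) \<le> ereal b"
        using sub[of k] unfolding subdifferential_def real[symmetric] by blast
      then show ?thesis
        by (cases "h (x k)") auto
    qed
    moreover have "(\<lambda>k. b - v k \<bullet> (y - x k)) \<longlonglongrightarrow> b - v' \<bullet> (y - x')"
      by (intro tendsto_intros v x)
    ultimately have "h x' \<le> ereal (b - v' \<bullet> (y - x'))"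
      using closed_epigraph_limit[OF h x] by blast
    then show ?thesis
      using real by (cases "h x'") auto
  qed (use nm in auto)
qed

section \<open>Affine minorants from separation in the epigraph space\<close>

lemma affine_minorant_separation:
  fixes h :: "'a::euclidean_space \<Rightarrow> ereal"
  assumes h: "closed_proper_convex h" and r: "ereal r < h x"
  obtains a b \<gamma> where "0 \<le> b" "\<And>u \<rho>. h u \<le> ereal \<rho> \<Longrightarrow> \<gamma> < a \<bullet> u + b * \<rho>" "a \<bullet> x + b * r < \<gamma>"
proof -
  obtain u0 where "h u0 \<noteq> \<infinity>" and nm: "\<And>u. h u \<noteq> -\<infinity>"
    using h by (auto simp: closed_proper_convex_def)
  then obtain \<rho>0 where \<rho>0: "h u0 = ereal \<rho>0"
    by (cases "h u0") auto
  have "(x, r) \<notin> ereal_epigraph h"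
    using r by (simp add: ereal_epigraph_def)
  then obtain w \<gamma> where w: "w \<bullet> (x, r) < \<gamma>" "\<forall>e\<in>ereal_epigraph h. \<gamma> < w \<bullet> e"
    using separating_hyperplane_closed_point[of "ereal_epigraph h" "(x, r)"] h
    by (auto simp: closed_proper_convex_def)
  obtain a b where ab: "w = (a, b)"
    by fastforce
  have le: "\<gamma> < a \<bullet> u + b * \<rho>" if "h u \<le> ereal \<rho>" for u \<rho>
    using w(2) that unfolding ab ereal_epigraph_def by fastforce
  \<comment> \<open>The epigraph is unbounded upwards: for negative \<open>b\<close>, a point high
    enough above \<open>u0\<close> would violate the separation.\<close>
  have "0 \<le> b"
  proof (rule ccontr)
    assume "\<not> 0 \<le> b"
    define t where "t = max 0 ((\<gamma> - a \<bullet> u0 - b * \<rho>0) / b)"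
    have "t \<ge> 0" "b * t \<le> \<gamma> - a \<bullet> u0 - b * \<rho>0"
      using \<open>\<not> 0 \<le> b\<close> unfolding t_def by (auto simp: max_def field_simps)
    moreover have "\<gamma> < a \<bullet> u0 + b * (\<rho>0 + t)"
      using \<open>t \<ge> 0\<close> by (intro le) (simp add: \<rho>0)
    ultimately show False
      by (simp add: algebra_simps)
  qed
  then show thesis
    using that le w(1) unfolding ab by auto
qed

lemma affine_minorant_exists:
  fixes h :: "'a::euclidean_space \<Rightarrow> ereal"
  assumes h: "closed_proper_convex h"
  obtains t \<beta> where "\<And>u. ereal (\<beta> + t \<bullet> u) \<le> h u"
proof -
  obtain u0 where "h u0 \<noteq> \<infinity>" and nm: "\<And>u. h u \<noteq> -\<infinity>"
    using h by (auto simp: closed_proper_convex_def)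
  then obtain \<rho>0 where \<rho>0: "h u0 = ereal \<rho>0"
    by (cases "h u0") auto
  \<comment> \<open>A point just below the graph over the domain is separated, since there the
    hyperplane cannot be vertical: the points (u0, \<rho>0) and (u0, \<rho>0 - 1) lie on opposite
    sides.\<close>
  then have "ereal (\<rho>0 - 1) < h u0"
    by simp
  then obtain a b \<gamma> where b: "0 \<le> b" and le: "\<And>u \<rho>. h u \<le> ereal \<rho> \<Longrightarrow> \<gamma> < a \<bullet> u + b * \<rho>"
    and lt: "a \<bullet> u0 + b * (\<rho>0 - 1) < \<gamma>"
    using affine_minorant_separation[OF h] by metis
  have "b > 0"
    using le[of u0 \<rho>0] lt \<rho>0 by (simp add: algebra_simps)
  have "ereal (\<gamma> / b + (- a /\<^sub>R b) \<bullet> u) \<le> h u" for u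
  proof (cases "h u")
    case (real \<rho>)
    then show ?thesis
      using le[of u \<rho>] \<open>b > 0\<close> by (simp add: field_simps)
  qed (use nm in auto)
  then show thesis
    using that by blast
qed

lemma affine_minorant_above:
  fixes h :: "'a::euclidean_space \<Rightarrow> ereal"
  assumes h: "closed_proper_convex h" and r: "ereal r < h x"
  obtains t \<beta> where "\<And>u. ereal (\<beta> + t \<bullet> u) \<le> h u" "r < \<beta> + t \<bullet> x"
proof -
  have nm: "\<And>u. h u \<noteq> -\<infinity>"
    using h by (auto simp: closed_proper_convex_def)
  obtain a b \<gamma> where b: "0 \<le> b" and le: "\<And>u \<rho>. h u \<le> ereal \<rho> \<Longrightarrow> \<gamma> < a \<bullet> u + b * \<rho>"
    and lt: "a \<bullet> x + b * r < \<gamma>"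
    using affine_minorant_separation[OF h r] by metis
  show thesis
  proof (cases "b = 0")
    case False
    then have "b > 0"
      using b by simp
    have "ereal (\<gamma> / b + (- a /\<^sub>R b) \<bullet> u) \<le> h u" for u
    proof (cases "h u")
      case (real \<rho>)
      then show ?thesis
        using le[of u \<rho>] \<open>b > 0\<close> by (simp add: field_simps)
    qed (use nm in auto)
    moreover have "r < \<gamma> / b + (- a /\<^sub>R b) \<bullet> x"
      using lt \<open>b > 0\<close> by (simp add: field_simps)
    ultimately show thesis
      using that by blast
  next
    case True
    \<comment> \<open>A vertical hyperplane: tilt some affine minorant by a large multiple of it.\<close>
    obtain t \<beta> where min: "\<And>u. ereal (\<beta> + t \<bullet> u) \<le> h u"
      using affine_minorant_exists[OF h] by metis
    have gap: "\<gamma> - a \<bullet> x > 0"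
      using lt True by simp
    define \<tau> where "\<tau> = max 0 ((r - \<beta> - t \<bullet> x) / (\<gamma> - a \<bullet> x) + 1)"
    have \<tau>: "\<tau> \<ge> 0" "\<tau> * (\<gamma> - a \<bullet> x) > r - \<beta> - t \<bullet> x"
    proof -
      have "\<tau> > (r - \<beta> - t \<bullet> x) / (\<gamma> - a \<bullet> x)"
        unfolding \<tau>_def by linarith
      then show "\<tau> * (\<gamma> - a \<bullet> x) > r - \<beta> - t \<bullet> x"
        using gap by (simp add: field_simps)
    qed (simp add: \<tau>_def)
    have "ereal ((\<beta> + \<tau> * \<gamma>) + (t - \<tau> *\<^sub>R a) \<bullet> u) \<le> h u" for u
    proof (cases "h u")
      case (real \<rho>)
      have "\<gamma> \<le> a \<bullet> u"
        using le[of u \<rho>] real True by simp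
      then have "\<tau> * \<gamma> \<le> \<tau> * (a \<bullet> u)"
        using \<tau>(1) by (rule mult_left_mono)
      then show ?thesis
        using min[of u] real by (simp add: inner_diff_left)
    qed (use nm in auto)
    moreover have "r < (\<beta> + \<tau> * \<gamma>) + (t - \<tau> *\<^sub>R a) \<bullet> x"
      using \<tau>(2) by (simp add: algebra_simps inner_diff_left)
    ultimately show thesis
      using that by blast
  qed
qed

lemma subdifferential_conjugate:
  assumes f: "closed_proper_convex f" and s: "s \<in> subdifferential f x"
  shows "x \<in> subdifferential (convex_conjugate f) s" and "convex_conjugate f s \<noteq> \<infinity>"
proof -
  obtain u where u: "f u \<noteq> \<infinity>" and nm: "\<And>u. f u \<noteq> -\<infinity>"
    using f by (auto simp: closed_proper_convex_def)
  obtain a where a: "f x = ereal a"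
    using subdifferential_dom[OF s u] nm[of x] by (cases "f x") auto
  have le: "convex_conjugate f s \<le> ereal (s \<bullet> x - a)"
    unfolding conjugate_le_iff[of f, OF nm]
  proof
    fix u
    show "ereal (s \<bullet> u - (s \<bullet> x - a)) \<le> f u"
      using s[unfolded subdifferential_def] a by (simp add: inner_diff_right algebra_simps)
  qed
  then show "convex_conjugate f s \<noteq> \<infinity>"
    by auto
  show "x \<in> subdifferential (convex_conjugate f) s"
    unfolding subdifferential_def
  proof (intro CollectI allI)
    fix t
    have "convex_conjugate f s + ereal (x \<bullet> (t - s)) \<le> ereal (s \<bullet> x - a) + ereal (x \<bullet> (t - s))"
      using le by (rule add_right_mono)
    also have "\<dots> = ereal (t \<bullet> x) - f x"
      by (simp add: a inner_diff_right inner_commute)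
    also have "\<dots> \<le> convex_conjugate f t"
      by (rule conjugate_ge)
    finally show "convex_conjugate f s + ereal (x \<bullet> (t - s)) \<le> convex_conjugate f t" .
  qed
qed

text \<open>Only the passage back to \<open>f\<close> uses closedness. If \<open>f x\<close>
  exceeded s \<bullet> x minus the conjugate value at \<open>s\<close>, some affine minorant would
  still exceed that value at \<open>x\<close>; the conjugate at its slope \<open>t\<close> would
  then be too small for \<open>x\<close> to be a subgradient at \<open>s\<close>.\<close>

lemma subdifferential_conjugate_iff:
  assumes f: "closed_proper_convex f"
  shows "x \<in> subdifferential (convex_conjugate f) s \<longleftrightarrow> s \<in> subdifferential f x"
proof
  assume x: "x \<in> subdifferential (convex_conjugate f) s"
  obtain u0 where u0: "f u0 \<noteq> \<infinity>" and nm: "\<And>u. f u \<noteq> -\<infinity>"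
    using f by (auto simp: closed_proper_convex_def)
  obtain t0 \<beta>0 where min: "\<And>u. ereal (\<beta>0 + t0 \<bullet> u) \<le> f u"
    using affine_minorant_exists[OF f] by metis
  have conj: "convex_conjugate f t \<le> ereal (- \<beta>)" if "\<And>u. ereal (\<beta> + t \<bullet> u) \<le> f u" for t \<beta>
    unfolding conjugate_le_iff[of f, OF nm] using that by (simp add: algebra_simps)
  have "convex_conjugate f t0 \<noteq> \<infinity>"
    using conj[OF min] by auto
  then obtain a where a: "convex_conjugate f s = ereal a"
    using subdifferential_dom[OF x] conjugate_not_MInf[of f, OF u0, of s]
    by (cases "convex_conjugate f s") auto
  have "f x \<le> ereal (x \<bullet> s - a)"
  proof (rule ccontr)
    assume "\<not> f x \<le> ereal (x \<bullet> s - a)"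
    then have "ereal (x \<bullet> s - a) < f x"
      by simp
    then obtain t \<beta> where t: "\<And>u. ereal (\<beta> + t \<bullet> u) \<le> f u" "x \<bullet> s - a < \<beta> + t \<bullet> x"
      using affine_minorant_above[OF f] by metis
    have "ereal a + ereal (x \<bullet> (t - s)) \<le> convex_conjugate f t"
      using x by (simp add: a subdifferential_def)
    also have "\<dots> \<le> ereal (- \<beta>)"
      by (rule conj[OF t(1)])
    finally show False
      using t(2) by (simp add: inner_diff_right inner_commute)
  qed
  then have "f x + ereal (s \<bullet> (u - x)) \<le> ereal (x \<bullet> s - a) + ereal (s \<bullet> (u - x))" for u
    by (rule add_right_mono)
  then have "f x + ereal (s \<bullet> (u - x)) \<le> ereal (s \<bullet> u - a)" for u
    by (simp add: inner_diff_right inner_commute[of x])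
  moreover have "ereal (s \<bullet> u - a) \<le> f u" for u
    using conjugate_le_iff[of f, OF nm, of s a] a by simp
  ultimately show "s \<in> subdifferential f x"
    unfolding subdifferential_def by (blast intro: order_trans)
qed (rule subdifferential_conjugate(1)[OF f])

section \<open>Optimality and the chain rule under the relative interior condition\<close>

text \<open>Minimality and convexity along the segment from \<open>u\<close> to \<open>w\<close> are
  divided by \<open>t\<close>, and t decreases to 0, which removes the second-order coefficient
  \<open>K w\<close>. The exact expansion of \<open>q\<close> encodes its gradient \<open>v\<close>,
  so both subproblems and the resolvent are covered.\<close>

lemma minimizer_subgradient:
  assumes f: "closed_proper_convex f"
    and min: "\<And>w. f u + ereal (q u) \<le> f w + ereal (q w)"
    and q: "\<And>w t. q (u + t *\<^sub>R (w - u)) = q u + t * (v \<bullet> (w - u)) + t\<^sup>2 * K w"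
  shows "- v \<in> subdifferential f u"
proof -
  obtain w0 where w0: "f w0 \<noteq> \<infinity>" and nm: "\<And>u. f u \<noteq> -\<infinity>"
    and conv: "convex (ereal_epigraph f)"
    using f by (auto simp: closed_proper_convex_def)
  obtain a where a: "f u = ereal a"
    using min[of w0] w0 nm[of u] nm[of w0] by (cases "f u"; cases "f w0") auto
  have "ereal a + ereal (- v \<bullet> (w - u)) \<le> f w" for w
  proof (cases "f w")
    case (real b)
    have ineq: "0 \<le> b - a + v \<bullet> (w - u) + t * K w" if t: "0 < t" "t \<le> 1" for t
    proof -
      have "(1 - t) *\<^sub>R (u, a) + t *\<^sub>R (w, b) \<in> ereal_epigraph f"
        by (rule convexD_alt[OF conv]) (use a real t in \<open>auto simp: ereal_epigraph_def\<close>)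
      then have "f (u + t *\<^sub>R (w - u)) \<le> ereal ((1 - t) * a + t * b)"
        by (simp add: ereal_epigraph_def algebra_simps)
      then have "ereal a + ereal (q u) \<le> ereal ((1 - t) * a + t * b) + ereal (q (u + t *\<^sub>R (w - u)))"
        using min[of "u + t *\<^sub>R (w - u)"] add_right_mono order_trans unfolding a by blast
      then have "0 \<le> t * (b - a + v \<bullet> (w - u) + t * K w)"
        by (simp add: q) (simp add: algebra_simps power2_eq_square)
      then show ?thesis
        using t(1) by (simp add: zero_le_mult_iff)
    qed
    have "0 \<le> b - a + v \<bullet> (w - u)"
    proof (rule tendsto_lowerbound)
      show "((\<lambda>t. b - a + v \<bullet> (w - u) + t * K w) \<longlongrightarrow> b - a + v \<bullet> (w - u)) (at_right 0)"
        by (auto intro!: tendsto_eq_intros)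
      show "\<forall>\<^sub>F t in at_right 0. 0 \<le> b - a + v \<bullet> (w - u) + t * K w"
        unfolding eventually_at_right_field by (rule exI[of _ 1]) (use ineq in auto)
    qed simp
    then show ?thesis
      by (simp add: real)
  qed (use nm in auto)
  then show ?thesis
    by (simp add: subdifferential_def a)
qed

text \<open>The set \<open>C\<close>, closed upwards, is separated from the strict hypograph
  \<open>D\<close> of the given affine function over \<open>K\<close>. Plain separation could return
  a vertical hyperplane; taking the normal in the span of the difference set \<open>E\<close> and
  using the common point \<open>s1\<close> excludes this.\<close>

lemma affine_minorant_extension:
  fixes C :: "('a::euclidean_space \<times> real) set"
  assumes C: "convex C" and up: "\<And>s r r'. (s, r) \<in> C \<Longrightarrow> r \<le> r' \<Longrightarrow> (s, r') \<in> C"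
    and K: "affine K" and s1: "s1 \<in> K" "s1 \<in> rel_interior (fst ` C)"
    and le: "\<And>s r. (s, r) \<in> C \<Longrightarrow> s \<in> K \<Longrightarrow> \<alpha> + x0 \<bullet> s \<le> r"
  obtains x \<beta> where "\<And>s r. (s, r) \<in> C \<Longrightarrow> \<beta> + x \<bullet> s \<le> r"
    "\<And>s. s \<in> K \<Longrightarrow> \<beta> + x \<bullet> s = \<alpha> + x0 \<bullet> s"
proof -
  define D where "D = {(t, \<tau>). t \<in> K \<and> \<tau> < \<alpha> + x0 \<bullet> t}"
  define E where "E = (\<Union>c\<in>C. \<Union>d\<in>D. {c - d})"
  obtain r1 where r1: "(s1, r1) \<in> C"
    using s1(2) rel_interior_subset by fastforce
  define \<tau>1 where "\<tau>1 = \<alpha> + x0 \<bullet> s1 - 1"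
  have \<tau>1: "(s1, \<tau>1) \<in> D"
    by (simp add: D_def \<tau>1_def s1)
  have "D = (K \<times> UNIV) \<inter> {w. (- x0, 1) \<bullet> w < \<alpha>}"
    by (auto simp: D_def)
  then have "convex D"
    by (simp add: convex_Int convex_Times affine_imp_convex K convex_halfspace_lt)
  then have "convex E"
    unfolding E_def using C by (rule convex_differences[rotated])
  moreover have "E \<noteq> {}"
    using r1 \<tau>1 by (auto simp: E_def)
  moreover have "0 \<notin> E"
    using le by (fastforce simp: E_def D_def)
  ultimately obtain v where v: "v \<in> span E" "v \<noteq> 0" "\<And>w. w \<in> E \<Longrightarrow> 0 \<le> v \<bullet> w"
    using separating_hyperplane_set_0_inspan by blast
  obtain a b where ab: "v = (a, b)"
    by fastforce
  have sep: "0 \<le> a \<bullet> (s - t) + b * (r - \<tau>)" if "(s, r) \<in> C" "(t, \<tau>) \<in> D" for s r t \<tau>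
  proof -
    have "(s, r) - (t, \<tau>) \<in> E"
      using that unfolding E_def by blast
    from v(3)[OF this] show ?thesis
      by (simp add: ab)
  qed
  have "b \<ge> 0"
  proof (rule ccontr)
    assume "\<not> b \<ge> 0"
    define R where "R = max r1 (\<tau>1 + 1)"
    have "0 \<le> b * (R - \<tau>1)"
      using sep[OF up[OF r1, of R] \<tau>1] by (simp add: R_def)
    moreover have "R - \<tau>1 > 0"
      by (simp add: R_def)
    ultimately show False
      using \<open>\<not> b \<ge> 0\<close> by (simp add: zero_le_mult_iff)
  qed
  \<comment> \<open>A vertical normal would make \<open>a\<close> constant on the projection of
    \<open>C\<close>, because \<open>s1\<close> minimizes it there and segments can be prolonged
    beyond \<open>s1\<close>, and constant on \<open>K\<close> with the same value. Then
    \<open>v\<close> is orthogonal to \<open>E\<close> although it lies in the span of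
    \<open>E\<close>.\<close>
  have "b \<noteq> 0"
  proof
    assume "b = 0"
    have le0: "a \<bullet> t \<le> a \<bullet> s" if s: "s \<in> fst ` C" and t: "t \<in> K" for s t
    proof -
      obtain r where "(s, r) \<in> C"
        using s by auto
      moreover have "(t, \<alpha> + x0 \<bullet> t - 1) \<in> D"
        using t by (simp add: D_def)
      ultimately show ?thesis
        using sep \<open>b = 0\<close> by (fastforce simp: inner_diff_right)
    qed
    have D0: "a \<bullet> s = a \<bullet> s1" if s: "s \<in> fst ` C" for s
    proof -
      have "convex (fst ` C)"
        using C by (simp add: convex_linear_image linear_fst)
      then obtain e where e: "e > 1" "(1 - e) *\<^sub>R s + e *\<^sub>R s1 \<in> fst ` C"
        using bspec[OF convex_rel_interior_if2[OF _ s1(2)] hull_inc[OF s]] by metis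
      have "a \<bullet> s1 \<le> (1 - e) * (a \<bullet> s) + e * (a \<bullet> s1)"
        using le0[OF e(2) s1(1)] by (simp add: inner_add_right)
      then have "(e - 1) * (a \<bullet> s) \<le> (e - 1) * (a \<bullet> s1)"
        by (simp add: algebra_simps)
      then have "a \<bullet> s \<le> a \<bullet> s1"
        using e(1) by simp
      then show ?thesis
        using le0[OF s s1(1)] by simp
    qed
    have K0: "a \<bullet> t = a \<bullet> s1" if t: "t \<in> K" for t
    proof -
      \<comment> \<open>Reflecting \<open>t\<close> in \<open>s1\<close> stays inside the affine set
        and yields the opposite inequality.\<close>
      have "2 *\<^sub>R s1 + (- 1) *\<^sub>R t \<in> K"
        by (rule mem_affine[OF K s1(1) t]) simp
      moreover have s1C: "s1 \<in> fst ` C"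
        using r1 by force
      ultimately have "a \<bullet> (2 *\<^sub>R s1 + (- 1) *\<^sub>R t) \<le> a \<bullet> s1"
        using le0 by blast
      then show ?thesis
        using le0[OF s1C t] by (simp add: inner_diff_right)
    qed
    have "orthogonal v w" if wE: "w \<in> E" for w
    proof -
      obtain s r t \<tau> where w: "w = (s - t, r - \<tau>)" "(s, r) \<in> C" "(t, \<tau>) \<in> D"
        using wE by (auto simp: E_def)
      have "a \<bullet> s = a \<bullet> s1"
        using w(2) by (intro D0) (rule image_eqI[of _ _ "(s, r)"], auto)
      moreover have "a \<bullet> t = a \<bullet> s1"
        using w(3) by (intro K0) (simp add: D_def)
      ultimately show ?thesis
        by (simp add: ab w \<open>b = 0\<close> orthogonal_def inner_diff_right)
    qed
    then have "orthogonal v v"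
      using orthogonal_to_span[OF v(1)] by blast
    then show False
      using v(2) by (simp add: orthogonal_def)
  qed
  then have b: "b > 0"
    using \<open>b \<ge> 0\<close> by simp
  define c where "c = a /\<^sub>R b"
  have sep': "\<alpha> + x0 \<bullet> t + c \<bullet> t \<le> r + c \<bullet> s" if "(s, r) \<in> C" "t \<in> K" for s r t
  proof -
    have "\<tau> \<le> r + c \<bullet> s - c \<bullet> t" if "\<tau> < \<alpha> + x0 \<bullet> t" for \<tau>
    proof -
      have "0 \<le> a \<bullet> (s - t) + b * (r - \<tau>)"
        by (rule sep) (use \<open>(s, r) \<in> C\<close> \<open>t \<in> K\<close> that in \<open>auto simp: D_def\<close>)
      then have "0 \<le> b * (c \<bullet> (s - t) + (r - \<tau>))"
        using b by (simp add: c_def distrib_left mult.assoc[symmetric])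
      then show ?thesis
        using b by (simp add: zero_le_mult_iff inner_diff_right)
    qed
    then have "\<alpha> + x0 \<bullet> t \<le> r + c \<bullet> s - c \<bullet> t"
      by (rule dense_le)
    then show ?thesis
      by simp
  qed
  \<comment> \<open>An affine function bounded above on an affine set is constant. The factor \<mu>
    selects the point on the line through \<open>s1\<close> and \<open>t\<close> where the upper
    bound would be exceeded by exactly 1.\<close>
  have const: "(x0 + c) \<bullet> t = (x0 + c) \<bullet> s1" if t: "t \<in> K" for t
  proof (rule ccontr)
    assume ne: "(x0 + c) \<bullet> t \<noteq> (x0 + c) \<bullet> s1"
    define y where "y = (x0 + c) \<bullet> (t - s1)"
    have "y \<noteq> 0"
      using ne by (simp add: y_def inner_diff_right)
    define \<mu> where "\<mu> = (r1 + c \<bullet> s1 - \<alpha> - (x0 + c) \<bullet> s1 + 1) / y"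
    have "(1 - \<mu>) *\<^sub>R s1 + \<mu> *\<^sub>R t \<in> K"
      by (rule mem_affine[OF K s1(1) t]) simp
    from sep'[OF r1 this]
    have "\<alpha> + (x0 + c) \<bullet> ((1 - \<mu>) *\<^sub>R s1 + \<mu> *\<^sub>R t) \<le> r1 + c \<bullet> s1"
      by (simp add: inner_add_left)
    moreover have "(x0 + c) \<bullet> ((1 - \<mu>) *\<^sub>R s1 + \<mu> *\<^sub>R t) = (x0 + c) \<bullet> s1 + \<mu> * y"
      by (simp add: y_def inner_add_right inner_diff_right algebra_simps)
    moreover have "\<mu> * y = r1 + c \<bullet> s1 - \<alpha> - (x0 + c) \<bullet> s1 + 1"
      using \<open>y \<noteq> 0\<close> by (simp add: \<mu>_def)
    ultimately show False
      by simp
  qed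
  show thesis
  proof (rule that)
    show "(\<alpha> + (x0 + c) \<bullet> s1) + (- c) \<bullet> s \<le> r" if "(s, r) \<in> C" for s r
      using sep'[OF that s1(1)] by (simp add: inner_add_left)
    show "(\<alpha> + (x0 + c) \<bullet> s1) + (- c) \<bullet> s = \<alpha> + x0 \<bullet> s" if "s \<in> K" for s
      using const[OF that] by (simp add: inner_add_left)
  qed
qed

lemma fst_ereal_epigraph:
  assumes "\<And>x. h x \<noteq> -\<infinity>"
  shows "fst ` ereal_epigraph h = {x. h x \<noteq> \<infinity>}"
proof -
  have "h x \<noteq> \<infinity> \<longleftrightarrow> (\<exists>r. h x \<le> ereal r)" for x
    using assms[of x] by (cases "h x") auto
  then show ?thesis
    by (force simp: ereal_epigraph_def)
qed

text \<open>Allowing any affine \<open>K\<close> serves two purposes: a singleton \<open>K\<close>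
  gives a subgradient at each relative interior point of the domain, and K = im M^T gives the chain
  rule for the composed conjugate.\<close>

lemma subgradient_extension:
  assumes h: "closed_proper_convex h" and K: "affine K" and s0: "s0 \<in> K"
    and s1: "s1 \<in> K" "s1 \<in> rel_interior {s. h s \<noteq> \<infinity>}"
    and sub: "\<And>s. s \<in> K \<Longrightarrow> h s0 + ereal (x0 \<bullet> (s - s0)) \<le> h s"
  obtains x where "x \<in> subdifferential h s0" "\<And>s. s \<in> K \<Longrightarrow> x \<bullet> (s - s0) = x0 \<bullet> (s - s0)"
proof -
  have nm: "\<And>u. h u \<noteq> -\<infinity>"
    using h by (auto simp: closed_proper_convex_def)
  have "h s1 \<noteq> \<infinity>"
    using s1(2) rel_interior_subset by fastforce
  then have "h s0 \<noteq> \<infinity>"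
    using sub[OF s1(1)] by auto
  then obtain a where a: "h s0 = ereal a"
    using nm[of s0] by (cases "h s0") auto
  have le: "(a - x0 \<bullet> s0) + x0 \<bullet> s \<le> r" if "(s, r) \<in> ereal_epigraph h" "s \<in> K" for s r
  proof -
    have "ereal a + ereal (x0 \<bullet> (s - s0)) \<le> ereal r"
      using that(1) sub[OF that(2)] unfolding a ereal_epigraph_def
      by (blast intro: order_trans)
    then show ?thesis
      by (simp add: inner_diff_right)
  qed
  have up: "(s, r') \<in> ereal_epigraph h" if "(s, r) \<in> ereal_epigraph h" "r \<le> r'" for s r r'
    using that by (auto simp: ereal_epigraph_def elim: order_trans)
  have ri: "s1 \<in> rel_interior (fst ` ereal_epigraph h)"
    unfolding fst_ereal_epigraph[of h, OF nm] by (rule s1(2))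
  have conv: "convex (ereal_epigraph h)"
    using h by (simp add: closed_proper_convex_def)
  obtain x \<beta> where x: "\<And>s r. (s, r) \<in> ereal_epigraph h \<Longrightarrow> \<beta> + x \<bullet> s \<le> r"
    "\<And>s. s \<in> K \<Longrightarrow> \<beta> + x \<bullet> s = (a - x0 \<bullet> s0) + x0 \<bullet> s"
    by (rule affine_minorant_extension[OF conv _ K s1(1) ri, of "a - x0 \<bullet> s0" x0])
      (use up le in blast)+
  have a': "a = \<beta> + x \<bullet> s0"
    using x(2)[OF s0] by simp
  show thesis
  proof (rule that)
    have "ereal (\<beta> + x \<bullet> s) \<le> h s" for s
      using x(1)[of s] nm[of s] by (cases "h s") (auto simp: ereal_epigraph_def)
    then show "x \<in> subdifferential h s0"
      by (simp add: subdifferential_def a a' inner_diff_right)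
    show "x \<bullet> (s - s0) = x0 \<bullet> (s - s0)" if "s \<in> K" for s
      using x(2)[OF that] a' by (simp add: inner_diff_right)
  qed
qed

lemma convex_dom:
  assumes "closed_proper_convex h"
  shows "convex {s. h s \<noteq> \<infinity>}"
proof -
  have "{s. h s \<noteq> \<infinity>} = fst ` ereal_epigraph h"
    using assms by (intro fst_ereal_epigraph[symmetric]) (simp add: closed_proper_convex_def)
  then show ?thesis
    using assms by (simp add: convex_linear_image linear_fst closed_proper_convex_def)
qed

lemma subdifferential_rel_interior:
  assumes h: "closed_proper_convex h" and s: "s \<in> rel_interior {s. h s \<noteq> \<infinity>}"
  shows "\<exists>x. x \<in> subdifferential h s"
  by (rule subgradient_extension[OF h affine_sing[of s] _ _ s, of s 0]) auto

text \<open>Subgradients of the conjugate exist on the relative interior of its domain, so im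
  \<partial>f contains that relative interior and is contained in the domain. Both sets then have
  the same affine hull.\<close>

lemma rel_interior_range_subdifferential:
  assumes f: "closed_proper_convex f" and h: "closed_proper_convex (convex_conjugate f)"
  shows "rel_interior (\<Union>u. subdifferential f u) \<subseteq> rel_interior {s. convex_conjugate f s \<noteq> \<infinity>}"
proof (rule subset_rel_interior)
  let ?D = "{s. convex_conjugate f s \<noteq> \<infinity>}" and ?I = "\<Union>u. subdifferential f u"
  show sub: "?I \<subseteq> ?D"
    using subdifferential_conjugate(2)[OF f] by blast
  have "rel_interior ?D \<subseteq> ?I"
    using subdifferential_rel_interior[OF h] subdifferential_conjugate_iff[OF f] by blast
  then have "affine hull ?D \<subseteq> affine hull ?I"
    using rel_interior_same_affine_hull[OF convex_dom[OF h]] hull_mono by metis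
  then show "affine hull ?I = affine hull ?D"
    using sub by (simp add: hull_mono subset_antisym)
qed

text \<open>Once \<open>z\<close> is known to be some M x0, the hypothesis says that
  \<open>x0\<close> is a subgradient of the conjugate at \<open>s0\<close> relative to im M^T.
  Extending it to the whole space changes \<open>x0\<close> but not its image under M.\<close>

lemma subdifferential_conjugate_comp:
  fixes f :: "real^'n \<Rightarrow> ereal" and M :: "real^'n^'m"
  assumes f: "closed_proper_convex f" and h: "closed_proper_convex (convex_conjugate f)"
    and sub: "- z \<in> subdifferential (convex_conjugate f \<circ> (\<lambda>q. - (transpose M *v q))) p"
    and ri: "rel_interior (\<Union>u. subdifferential f u) \<inter> range (\<lambda>q. transpose M *v q) \<noteq> {}"
  obtains x where "z = M *v x" "- (transpose M *v p) \<in> subdifferential f x"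
proof -
  let ?h = "convex_conjugate f"
  define K where "K = range (\<lambda>q. transpose M *v q)"
  define s0 where "s0 = - (transpose M *v p)"
  have linT: "linear (\<lambda>q. transpose M *v q)" and linM: "linear (\<lambda>x. M *v x)"
    by (rule matrix_vector_mul_linear)+
  have "subspace K"
    unfolding K_def by (rule linear_subspace_image[OF linT subspace_UNIV])
  have adj: "(transpose M *v q) \<bullet> x = q \<bullet> (M *v x)" for q x
    by (simp add: dot_lmul_matrix)
  obtain s1 where s1: "s1 \<in> K" "s1 \<in> rel_interior {s. ?h s \<noteq> \<infinity>}"
    using ri rel_interior_range_subdifferential[OF f h] unfolding K_def by blast
  have le: "?h s0 + ereal (- z \<bullet> (q - p)) \<le> ?h (- (transpose M *v q))" for q
    using sub by (simp add: subdifferential_def s0_def)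
  have "?h s1 \<noteq> \<infinity>"
    using s1(2) rel_interior_subset by fastforce
  moreover obtain q1 where "s1 = - (transpose M *v q1)"
    using s1(1) unfolding K_def by (metis (no_types, lifting) imageE linear_neg linT minus_minus)
  ultimately have "?h s0 \<noteq> \<infinity>"
    using le[of q1] by auto
  then obtain a where a: "?h s0 = ereal a"
    using h by (cases "?h s0") (auto simp: closed_proper_convex_def)
  \<comment> \<open>To show that \<open>z\<close> is in the range of M, let \<open>w\<close> be its
    component orthogonal to that range. Then M^T w = 0, so moving from \<open>p\<close> to p - w
    leaves the composed function unchanged, and the subgradient inequality forces w = 0.\<close>
  obtain y w where y: "y \<in> span (range (\<lambda>x. M *v x))" and zyw: "z = y + w"
    and orth: "\<And>u. u \<in> span (range (\<lambda>x. M *v x)) \<Longrightarrow> orthogonal w u"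
    using orthogonal_subspace_decomp_exists[of "range (\<lambda>x. M *v x)" z] by metis
  have w0: "w \<bullet> (M *v x) = 0" for x
    using orth[OF span_base[of "M *v x"]] by (simp add: orthogonal_def)
  have "transpose M *v w = 0"
    using adj[of w "transpose M *v w"] w0 by (metis inner_eq_zero_iff)
  then have "- (transpose M *v (p - w)) = s0"
    by (simp only: s0_def matrix_vector_mult_diff_distrib) simp
  then have "z \<bullet> w \<le> 0"
    using le[of "p - w"] a by simp
  moreover have "w \<bullet> y = 0"
    using orth[OF y] by (simp add: orthogonal_def)
  ultimately have "w \<bullet> w \<le> 0"
    by (simp add: zyw inner_add_left inner_commute[of y])
  then have "w = 0"
    using inner_gt_zero_iff[of w] by linarith
  moreover have "y \<in> range (\<lambda>x. M *v x)"
    using y linear_subspace_image[OF linM subspace_UNIV] span_eq_iff by blast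
  ultimately obtain x0 where x0: "z = M *v x0"
    using zyw by auto
  have minor: "?h s0 + ereal (x0 \<bullet> (s - s0)) \<le> ?h s" if sK: "s \<in> K" for s
  proof -
    obtain q where q: "s = - (transpose M *v q)"
      using sK unfolding K_def by (metis (no_types, lifting) imageE linear_neg linT minus_minus)
    have "x0 \<bullet> (s - s0) = - z \<bullet> (q - p)"
      using adj[of q x0] adj[of p x0]
      by (simp add: q s0_def x0 inner_diff_right inner_commute)
    then show ?thesis
      using le[of q] q by simp
  qed
  have "s0 \<in> K"
    unfolding s0_def K_def by (metis linear_neg linT rangeI)
  obtain x where x: "x \<in> subdifferential ?h s0"
    "\<And>s. s \<in> K \<Longrightarrow> x \<bullet> (s - s0) = x0 \<bullet> (s - s0)"
    using subgradient_extension[OF h subspace_imp_affine[OF \<open>subspace K\<close>] \<open>s0 \<in> K\<close> s1 minor]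
    by blast
  \<comment> \<open>Agreement of \<open>x\<close> and \<open>x0\<close> in all directions M^T q is
    exactly M x = M x0.\<close>
  have "q \<bullet> (M *v x) = q \<bullet> (M *v x0)" for q
  proof -
    have "s0 + transpose M *v q \<in> K"
      using \<open>subspace K\<close> \<open>s0 \<in> K\<close> by (simp add: K_def subspace_add)
    from x(2)[OF this] show ?thesis
      using adj[of q x] adj[of q x0] by (simp add: inner_commute)
  qed
  then have "M *v x = z"
    using x0 vector_eq_ldot by metis
  then show thesis
    using that x(1) subdifferential_conjugate_iff[OF f] unfolding s0_def by metis
qed

section \<open>Inner products and resolvents\<close>

text \<open>The splitting operators are monotone for the form given by G, while boundedness and
  limits in the statement are Euclidean. Keeping a second inner product beside the standard one lets
  both be used; \<open>N_upper\<close> and \<open>N_lower\<close> translate between them.\<close>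

locale inner_form =
  fixes ip :: "'a::euclidean_space \<Rightarrow> 'a \<Rightarrow> real"
  assumes bounded_bilinear_ip: "bounded_bilinear ip"
    and ip_sym: "ip u v = ip v u"
    and ip_pos: "u \<noteq> 0 \<Longrightarrow> ip u u > 0"
begin

sublocale bounded_bilinear ip
  by (rule bounded_bilinear_ip)

lemmas ip_simps = add_left add_right diff_left diff_right minus_left minus_right
  scaleR_left scaleR_right zero_left zero_right

lemma ip_nonneg: "0 \<le> ip u u"
  using ip_pos[of u] by (cases "u = 0") (auto simp: zero_left)

definition N :: "'a \<Rightarrow> real" where
  "N u = sqrt (ip u u)"

lemma N_nonneg [simp]: "0 \<le> N u"
  by (simp add: N_def ip_nonneg)

lemma N_sq: "(N u)\<^sup>2 = ip u u"
  by (simp add: N_def ip_nonneg)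

lemma N_zero [simp]: "N 0 = 0"
  by (simp add: N_def zero_left)

lemma N_eq_0_iff: "N u = 0 \<longleftrightarrow> u = 0"
  using ip_pos[of u] by (cases "u = 0") (auto simp: N_def zero_left)

lemma N_scaleR: "N (t *\<^sub>R u) = \<bar>t\<bar> * N u"
  by (simp add: N_def scaleR_left scaleR_right real_sqrt_mult mult.assoc[symmetric])

lemma N_minus: "N (- u) = N u"
  by (simp add: N_def minus_left minus_right)

lemma N_minus_commute: "N (u - v) = N (v - u)"
  using N_minus[of "u - v"] by simp

lemma N_add_sq: "(N (u + v))\<^sup>2 = (N u)\<^sup>2 + 2 * ip u v + (N v)\<^sup>2"
  by (simp add: N_sq add_left add_right ip_sym[of v u])

lemma N_diff_sq: "(N (u - v))\<^sup>2 = (N u)\<^sup>2 - 2 * ip u v + (N v)\<^sup>2"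
  by (simp add: N_sq diff_left diff_right ip_sym[of v u])

lemma ip_Cauchy_Schwarz: "\<bar>ip u v\<bar> \<le> N u * N v"
proof (cases "v = 0")
  case False
  have "0 \<le> (N ((N v)\<^sup>2 *\<^sub>R u - ip u v *\<^sub>R v))\<^sup>2"
    by simp
  also have "\<dots> = (N v)\<^sup>2 * ((N u)\<^sup>2 * (N v)\<^sup>2 - (ip u v)\<^sup>2)"
    unfolding N_sq by (simp add: ip_simps ip_sym[of v u]) (simp add: algebra_simps power2_eq_square)
  finally have "0 \<le> (N u)\<^sup>2 * (N v)\<^sup>2 - (ip u v)\<^sup>2"
    using False by (simp add: zero_le_mult_iff N_eq_0_iff)
  then have "(ip u v)\<^sup>2 \<le> (N u * N v)\<^sup>2"
    by (simp add: power_mult_distrib)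
  then show ?thesis
    by (rule abs_le_square_iff[THEN iffD2, of "ip u v" "N u * N v", simplified abs_of_nonneg[OF mult_nonneg_nonneg[OF N_nonneg N_nonneg]]])
qed (simp add: zero_right)

lemma N_triangle: "N (u + v) \<le> N u + N v"
proof (rule power2_le_imp_le)
  show "(N (u + v))\<^sup>2 \<le> (N u + N v)\<^sup>2"
    using ip_Cauchy_Schwarz[of u v] by (simp add: N_add_sq power2_sum)
qed simp

lemma N_triangle_diff: "\<bar>N u - N v\<bar> \<le> N (u - v)"
  using N_triangle[of "u - v" v] N_triangle[of "v - u" u] N_minus_commute[of u v] by simp

lemma continuous_on_N: "continuous_on S N"
  unfolding N_def by (intro continuous_on_real_sqrt continuous_on continuous_on_id)

lemma N_upper: obtains L where "L > 0" "\<And>u. N u \<le> L * norm u"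
proof -
  obtain K where K: "K > 0" "\<And>u v. norm (ip u v) \<le> norm u * norm v * K"
    using pos_bounded by blast
  have "N u \<le> sqrt K * norm u" for u
  proof -
    have "ip u u \<le> K * (norm u)\<^sup>2"
      using K(2)[of u u] by (simp add: power2_eq_square mult.commute)
    then have "N u \<le> sqrt (K * (norm u)\<^sup>2)"
      by (simp add: N_def)
    then show ?thesis
      by (simp add: real_sqrt_mult)
  qed
  then show thesis
    using that[of "sqrt K"] K(1) by simp
qed

lemma N_lower: obtains m where "m > 0" "\<And>u. m * norm u \<le> N u"
proof -
  obtain b :: 'a where b: "b \<in> Basis"
    using nonempty_Basis by blast
  then have "b \<in> sphere 0 1"
    by simp
  then obtain v where v: "v \<in> sphere 0 1" "\<And>u. u \<in> sphere 0 1 \<Longrightarrow> N v \<le> N u"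
    using continuous_attains_inf[OF compact_sphere _ continuous_on_N, of 0 1] by blast
  have "N v > 0"
    using v(1) N_eq_0_iff[of v] N_nonneg[of v] by (cases "v = 0") (auto simp: less_le)
  moreover have "N v * norm u \<le> N u" for u
  proof (cases "u = 0")
    case False
    have "N v \<le> N (u /\<^sub>R norm u)"
      by (rule v(2)) (use False in simp)
    then show ?thesis
      using False by (simp add: N_scaleR field_simps)
  qed simp
  ultimately show thesis
    using that by blast
qed

lemma bounded_iff_N: "bounded (range u) \<longleftrightarrow> (\<exists>B. \<forall>k. N (u k) \<le> B)"
proof
  assume "bounded (range u)"
  then obtain B where B: "\<And>k. norm (u k) \<le> B"
    by (auto simp: bounded_iff)
  obtain L where L: "L > 0" "\<And>u. N u \<le> L * norm u"
    using N_upper by blast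
  have "N (u k) \<le> L * B" for k
    using L(2)[of "u k"] mult_left_mono[OF B[of k], of L] L(1) by linarith
  then show "\<exists>B. \<forall>k. N (u k) \<le> B"
    by blast
next
  assume "\<exists>B. \<forall>k. N (u k) \<le> B"
  then obtain B where B: "\<And>k. N (u k) \<le> B"
    by blast
  obtain m where m: "m > 0" "\<And>u. m * norm u \<le> N u"
    using N_lower by blast
  have "norm (u k) \<le> B / m" for k
    using m(2)[of "u k"] B[of k] m(1) by (simp add: field_simps)
  then show "bounded (range u)"
    by (auto simp: bounded_iff)
qed

lemma tendsto_iff_N: "(u \<longlongrightarrow> l) F \<longleftrightarrow> ((\<lambda>k. N (u k - l)) \<longlongrightarrow> 0) F"
proof
  assume "(u \<longlongrightarrow> l) F"
  then have "((\<lambda>k. u k - l) \<longlongrightarrow> 0) F"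
    by (simp add: LIM_zero)
  then show "((\<lambda>k. N (u k - l)) \<longlongrightarrow> 0) F"
    using continuous_on_tendsto_compose[OF continuous_on_N[of UNIV], of "\<lambda>k. u k - l" 0 F] by simp
next
  obtain m where m: "m > 0" "\<And>u. m * norm u \<le> N u"
    using N_lower by blast
  assume lim: "((\<lambda>k. N (u k - l)) \<longlongrightarrow> 0) F"
  have "((\<lambda>k. u k - l) \<longlongrightarrow> 0) F"
  proof (rule Lim_null_comparison)
    show "\<forall>\<^sub>F k in F. norm (u k - l) \<le> N (u k - l) / m"
      using m by (simp add: field_simps)
    show "((\<lambda>k. N (u k - l) / m) \<longlongrightarrow> 0) F"
      using tendsto_divide[OF lim tendsto_const, of m] m(1) by simp
  qed
  then show "(u \<longlongrightarrow> l) F"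
    by (simp add: LIM_zero_iff)
qed

end

section \<open>Positive definite matrices as inner products, and existence of resolvents\<close>

lemma symmetric_pos_def_swap:
  assumes "symmetric_pos_def V"
  shows "(V *v u) \<bullet> w = u \<bullet> (V *v w)"
  using assms dot_lmul_matrix[of u V w] transpose_matrix_vector[of V u]
  by (simp add: symmetric_pos_def_def)

lemma inner_form_matrix:
  assumes "symmetric_pos_def V"
  shows "inner_form (\<lambda>u v. u \<bullet> (V *v v))"
proof
  have "bilinear (\<lambda>u v. u \<bullet> (V *v v))"
    by (auto simp: bilinear_def linear_iff algebra_simps inner_add_left inner_add_right)
  then have "bounded_bilinear (\<lambda>u v. u \<bullet> (V *v v))"
    by (simp add: bilinear_conv_bounded_bilinear)
  then interpret bounded_bilinear "\<lambda>u v. u \<bullet> (V *v v)" .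
  show "\<exists>K. \<forall>a b. norm (a \<bullet> (V *v b)) \<le> norm a * norm b * K"
    by (rule bounded)
  show "u \<bullet> (V *v v) = v \<bullet> (V *v u)" for u v
    using symmetric_pos_def_swap[OF assms, of u v] by (simp add: inner_commute)
  show "0 < u \<bullet> (V *v u)" if "u \<noteq> 0" for u
    using assms that by (simp add: symmetric_pos_def_def)
qed (auto simp: algebra_simps inner_add_left inner_add_right)

text \<open>The point \<open>q\<close> minimizes \<open>h\<close> plus half the squared V-distance
  to \<open>s\<close>. An affine minorant of \<open>h\<close> against the quadratic provides
  coercivity.\<close>

lemma resolvent_exists:
  assumes h: "closed_proper_convex h" and V: "symmetric_pos_def V"
  shows "\<exists>q. V *v (s - q) \<in> subdifferential h q"
proof -
  interpret inner_form "\<lambda>u v. u \<bullet> (V *v v)"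
    by (rule inner_form_matrix[OF V])
  obtain q0 where "h q0 \<noteq> \<infinity>" and nm: "\<And>u. h u \<noteq> -\<infinity>"
    using h by (auto simp: closed_proper_convex_def)
  then obtain r0 where r0: "h q0 = ereal r0"
    by (cases "h q0") auto
  obtain t \<beta> where min: "\<And>u. ereal (\<beta> + t \<bullet> u) \<le> h u"
    using affine_minorant_exists[OF h] by metis
  have min': "\<beta> + t \<bullet> q \<le> r" if "h q \<le> ereal r" for q r
    using order_trans[OF min that] by simp
  obtain m where m: "m > 0" "\<And>u. m * norm u \<le> N u"
    using N_lower by blast
  \<comment> \<open>Since \<open>h\<close> is merely lower semicontinuous, the minimization is
    carried out over its closed epigraph, where the objective is continuous and real-valued.\<close>
  define F where "F = (\<lambda>w :: _ \<times> real. snd w + (N (fst w - s))\<^sup>2 / 2)"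
  define R where "R = F (q0, r0)"
  define S where "S = ereal_epigraph h \<inter> {w. F w \<le> R}"
  have contF: "continuous_on UNIV F"
    unfolding F_def
    by (intro continuous_intros continuous_on_compose2[OF continuous_on_N[of UNIV]]) auto
  have "closed S"
    unfolding S_def using h contF
    by (intro closed_Int closed_Collect_le continuous_on_const) (auto simp: closed_proper_convex_def)
  moreover have "bounded S"
  proof -
    define D where "D = R - \<beta> - t \<bullet> s"
    \<comment> \<open>Beyond this radius the factor m^2/2 * |q - s| - |t| is at least 1, so the
      sublevel inequality would give |q - s| \<le> D, contradicting |D| < \<rho>.\<close>
    define \<rho> where "\<rho> = norm t / m\<^sup>2 * 2 + \<bar>D\<bar> + 2 / m\<^sup>2 + 1"
    have norm_le: "norm (q - s) \<le> \<rho>" if "(q, r) \<in> S" for q r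
    proof (rule ccontr)
      let ?n = "norm (q - s)"
      assume "\<not> ?n \<le> \<rho>"
      then have n: "?n > \<rho>"
        by simp
      have "\<beta> + t \<bullet> q \<le> r" "r + (N (q - s))\<^sup>2 / 2 \<le> R"
        using that min'[of q r] by (auto simp: S_def F_def ereal_epigraph_def)
      moreover have "(m * ?n)\<^sup>2 \<le> (N (q - s))\<^sup>2"
        using m by (intro power_mono) auto
      moreover have "- (norm t * ?n) \<le> t \<bullet> (q - s)"
        using Cauchy_Schwarz_ineq2[of t "q - s"] by linarith
      ultimately have "m\<^sup>2 / 2 * ?n\<^sup>2 \<le> D + norm t * ?n"
        by (simp add: D_def inner_diff_right power_mult_distrib)
      then have le: "?n * (m\<^sup>2 / 2 * ?n - norm t) \<le> D"
        by (simp add: algebra_simps power2_eq_square)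
      have "m\<^sup>2 / 2 * \<rho> \<ge> norm t + 1"
      proof -
        have "m\<^sup>2 / 2 * (norm t / m\<^sup>2 * 2 + 2 / m\<^sup>2) = norm t + 1"
          using m(1) by (simp add: field_simps)
        moreover have "m\<^sup>2 / 2 * (\<bar>D\<bar> + 1) \<ge> 0"
          by simp
        ultimately show ?thesis
          unfolding \<rho>_def by (simp add: algebra_simps)
      qed
      moreover have "m\<^sup>2 / 2 * \<rho> \<le> m\<^sup>2 / 2 * ?n"
        using n by (intro mult_left_mono) auto
      ultimately have "1 \<le> m\<^sup>2 / 2 * ?n - norm t"
        by linarith
      then have "?n * 1 \<le> ?n * (m\<^sup>2 / 2 * ?n - norm t)"
        by (intro mult_left_mono) auto
      moreover have "\<bar>D\<bar> < \<rho>"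
        unfolding \<rho>_def using m(1) by (simp add: add_nonneg_pos add_pos_nonneg)
      ultimately show False
        using le n by linarith
    qed
    have snd_le: "\<beta> + t \<bullet> q \<le> r \<and> r \<le> R" if "(q, r) \<in> S" for q r
      using that min'[of q r] by (auto simp: S_def F_def ereal_epigraph_def elim: order_trans[rotated])
    have "S \<subseteq> cball s \<rho> \<times> {\<beta> + t \<bullet> s - norm t * \<rho>..R}"
    proof
      fix w assume "w \<in> S"
      moreover obtain q r where w: "w = (q, r)"
        by fastforce
      ultimately have qr: "(q, r) \<in> S"
        by simp
      have "\<bar>t \<bullet> (q - s)\<bar> \<le> norm t * \<rho>"
        by (rule order_trans[OF Cauchy_Schwarz_ineq2]) (intro mult_left_mono norm_le[OF qr] norm_ge_zero)
      then have "\<beta> + t \<bullet> s - norm t * \<rho> \<le> r"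
        using snd_le[OF qr] by (simp add: inner_diff_right abs_le_iff)
      then show "w \<in> cball s \<rho> \<times> {\<beta> + t \<bullet> s - norm t * \<rho>..R}"
        using snd_le[OF qr] norm_le[OF qr] by (simp add: w dist_norm norm_minus_commute)
    qed
    then show ?thesis
      by (rule bounded_subset[rotated]) (intro bounded_Times bounded_cball bounded_closed_interval)
  qed
  ultimately have "compact S"
    by (simp add: compact_eq_bounded_closed)
  moreover have q0S: "(q0, r0) \<in> S"
    by (simp add: S_def R_def ereal_epigraph_def r0)
  ultimately obtain w where w: "w \<in> S" "\<And>w'. w' \<in> S \<Longrightarrow> F w \<le> F w'"
    using continuous_attains_inf[of S F] continuous_on_subset[OF contF] by blast
  obtain q r where qr: "w = (q, r)"
    by fastforce
  have hq: "h q \<le> ereal r"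
    using w(1) by (simp add: qr S_def ereal_epigraph_def)
  have opt: "h q + ereal ((N (q - s))\<^sup>2 / 2) \<le> h u + ereal ((N (u - s))\<^sup>2 / 2)" for u
  proof (cases "h u")
    case (real a)
    have "F (q, r) \<le> F (u, a)"
    proof (cases "(u, a) \<in> S")
      case False
      then have "F (u, a) > R"
        using real by (simp add: S_def ereal_epigraph_def)
      then show ?thesis
        using w(2)[OF q0S] by (simp add: qr R_def)
    qed (use w(2) qr in simp)
    then have "ereal r + ereal ((N (q - s))\<^sup>2 / 2) \<le> h u + ereal ((N (u - s))\<^sup>2 / 2)"
      by (simp add: F_def real)
    then show ?thesis
      using add_right_mono[OF hq] order_trans by blast
  qed (use nm in auto)
  have "- (V *v (q - s)) \<in> subdifferential h q"
  proof (rule minimizer_subgradient[OF h opt])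
    fix w t
    have "(N (q + t *\<^sub>R (w - q) - s))\<^sup>2 = (N ((q - s) + t *\<^sub>R (w - q)))\<^sup>2"
      by (simp add: algebra_simps)
    also have "\<dots> / 2 = (N (q - s))\<^sup>2 / 2 + t * ((V *v (q - s)) \<bullet> (w - q)) + t\<^sup>2 * ((N (w - q))\<^sup>2 / 2)"
      unfolding N_add_sq by (simp add: N_scaleR power_mult_distrib matrix_vector_mult_scaleR symmetric_pos_def_swap[OF V])
    finally show "(N (q + t *\<^sub>R (w - q) - s))\<^sup>2 / 2 =
      (N (q - s))\<^sup>2 / 2 + t * ((V *v (q - s)) \<bullet> (w - q)) + t\<^sup>2 * ((N (w - q))\<^sup>2 / 2)" .
  qed
  then show ?thesis
    by (metis linear_neg matrix_vector_mul_linear minus_diff_eq)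
qed

section \<open>Inexact relaxed Douglas-Rachford splitting\<close>

text \<open>Subtracting the partial sums of \<open>e\<close> leaves a decreasing sequence, bounded
  below because those sums are bounded.\<close>

lemma perturbed_decreasing_convergent:
  fixes D e :: "nat \<Rightarrow> real"
  assumes D: "\<And>k. 0 \<le> D k" and e: "summable e" and step: "\<And>k. D (Suc k) \<le> D k + e k"
  shows "convergent D"
proof -
  define F where "F k = D k - sum e {..<k}" for k
  obtain B where B: "\<And>k. \<bar>sum e {..<k}\<bar> \<le> B"
    using convergent_imp_Bseq[of "\<lambda>n. sum e {..<n}"] e
    by (auto simp: summable_iff_convergent Bseq_def real_norm_def)
  have "decseq F"
    by (rule decseq_SucI) (use step in \<open>simp add: F_def algebra_simps\<close>)
  moreover have "- B \<le> F k" for k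
    using B[of k] D[of k] by (simp add: F_def)
  ultimately have "convergent F"
    using decseq_convergent[of F "- B"] unfolding convergent_def by metis
  then have "convergent (\<lambda>k. F k + sum e {..<k})"
    using e by (intro convergent_add) (simp_all add: summable_iff_convergent)
  then show ?thesis
    by (simp add: F_def)
qed

text \<open>In the application \<open>(\<pi>, \<zeta>) \<in> B\<close> stands for \<open>\<zeta> \<in> \<partial>g\<^sup>*(G \<pi>)\<close> and \<open>(\<kappa>, \<eta>) \<in> A\<close> for
  \<open>- \<eta> \<in> \<partial>(f\<^sup>* \<circ> (- M\<^sup>T))(G \<kappa>)\<close>, hence the reversed sign of monotonicity of \<open>A\<close>.\<close>

locale inexact_splitting = inner_form ip
  for ip :: "'a::euclidean_space \<Rightarrow> 'a \<Rightarrow> real" +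
  fixes A B :: "('a \<times> 'a) set" and P z y u d :: "nat \<Rightarrow> 'a" and \<nu> :: "nat \<Rightarrow> real" and \<nu>min \<nu>max :: real
  assumes mono_B: "(\<pi>, \<zeta>) \<in> B \<Longrightarrow> (\<pi>', \<zeta>') \<in> B \<Longrightarrow> 0 \<le> ip (\<pi> - \<pi>') (\<zeta> - \<zeta>')"
    and mono_A: "(\<kappa>, \<eta>) \<in> A \<Longrightarrow> (\<kappa>', \<eta>') \<in> A \<Longrightarrow> ip (\<kappa> - \<kappa>') (\<eta> - \<eta>') \<le> 0"
    and closed_A: "closed A" and closed_B: "closed B"
    and in_B: "(P k + d k, z k - d k) \<in> B"
    and in_A: "(P k + (y k - z k), y k) \<in> A"
    and step: "P (Suc k) + z (Suc k) = P k + z k + \<nu> k *\<^sub>R (u k - z k)"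
    and \<nu>min: "0 < \<nu>min" "\<nu>min \<le> \<nu> k" and \<nu>max: "\<nu> k \<le> \<nu>max" "\<nu>max < 2"
    and summable_d: "summable (\<lambda>k. N (d k))"
    and summable_u: "summable (\<lambda>k. N (u k - y k))"
begin

text \<open>The governing sequence. It is also the sum of the perturbed pair
  \<open>(P k + d k, z k - d k)\<close> lying in \<open>B\<close>.\<close>

definition S :: "nat \<Rightarrow> 'a" where
  "S k = P k + z k"

text \<open>The displacement uses the exact point \<open>y k\<close>; the deviation of
  \<open>u k\<close> is kept as a separate summable term in \<open>S_Suc\<close>.\<close>

definition r :: "nat \<Rightarrow> 'a" where
  "r k = y k - z k"

lemma \<nu>_bounds: "0 < \<nu> k" "\<nu> k < 2"
  using \<nu>min \<nu>max by (meson less_le_trans le_less_trans)+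

lemma S_Suc: "S (Suc k) = S k + \<nu> k *\<^sub>R r k + \<nu> k *\<^sub>R (u k - y k)"
  using step[of k] by (simp add: S_def r_def algebra_simps)

lemma d_tendsto: "(\<lambda>k. N (d k)) \<longlonglongrightarrow> 0"
  by (rule summable_LIMSEQ_zero[OF summable_d])

lemma error_bound: "N (\<nu> k *\<^sub>R (u k - y k)) \<le> 2 * N (u k - y k)"
  using \<nu>_bounds[of k] by (simp add: N_scaleR mult_right_mono)

text \<open>Monotonicity of \<open>B\<close> makes the cross term nonnegative, so both components of
  a pair depend nonexpansively on its sum.\<close>

lemma resolvent_sq:
  assumes B: "(\<pi>, \<zeta>) \<in> B"
  shows "(N (P k + d k - \<pi>))\<^sup>2 + (N (z k - d k - \<zeta>))\<^sup>2 \<le> (N (S k - (\<pi> + \<zeta>)))\<^sup>2"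
proof -
  have eq: "S k - (\<pi> + \<zeta>) = (P k + d k - \<pi>) + (z k - d k - \<zeta>)"
    by (simp add: S_def)
  show ?thesis
    unfolding eq N_add_sq using mono_B[OF in_B[of k] B] by simp
qed

lemma resolvent_nonexpansive:
  assumes "(\<pi>, \<zeta>) \<in> B"
  shows "N (P k + d k - \<pi>) \<le> N (S k - (\<pi> + \<zeta>))" "N (z k - d k - \<zeta>) \<le> N (S k - (\<pi> + \<zeta>))"
proof -
  have "(N (P k + d k - \<pi>))\<^sup>2 \<le> (N (S k - (\<pi> + \<zeta>)))\<^sup>2"
    "(N (z k - d k - \<zeta>))\<^sup>2 \<le> (N (S k - (\<pi> + \<zeta>)))\<^sup>2"
    using resolvent_sq[OF assms, of k] zero_le_power2[of "N (P k + d k - \<pi>)"]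
      zero_le_power2[of "N (z k - d k - \<zeta>)"] by linarith+
  then show "N (P k + d k - \<pi>) \<le> N (S k - (\<pi> + \<zeta>))" "N (z k - d k - \<zeta>) \<le> N (S k - (\<pi> + \<zeta>))"
    by (auto intro: power2_le_imp_le)
qed

text \<open>Firm nonexpansiveness of the Douglas-Rachford operator with an error term: its
  displacements at \<open>S k\<close> and \<open>y0\<close> are \<open>r k\<close> and
  \<open>- g\<close>. With w = r k + g, the algebra is <a + b, w> + |w|^2 = <a + w, b + w> - <a, b>,
  where monotonicity of A controls the first product and that of B the second. The point
  \<open>y0\<close> may be arbitrary; at a fixed point g = 0.\<close>

lemma key_inequality:
  assumes B: "(\<pi>, \<zeta>) \<in> B" and A: "(\<kappa>, \<eta>) \<in> A" and eq: "\<kappa> - \<eta> = \<pi> - \<zeta>"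
  defines "y0 \<equiv> \<pi> + \<zeta>" and "g \<equiv> \<pi> - \<kappa>"
  shows "ip (S k - y0) (r k + g) + (N (r k + g))\<^sup>2 \<le> N (S k - y0) * N (d k) + (N (d k))\<^sup>2"
proof -
  let ?a = "P k - \<pi>" and ?b = "z k - \<zeta>"
  let ?\<alpha> = "?a + (r k + g)" and ?\<beta> = "?b + (r k + g)"
  have \<alpha>: "?\<alpha> = P k + (y k - z k) - \<kappa>"
    by (simp add: r_def g_def)
  have \<beta>: "?\<beta> = y k - \<eta>"
    using eq by (simp add: r_def g_def algebra_simps)
  have A0: "ip ?\<alpha> ?\<beta> \<le> 0"
    unfolding \<alpha> \<beta> by (rule mono_A[OF in_A A])
  have "0 \<le> ip (?a + d k) (?b - d k)"
    using mono_B[OF in_B[of k] B] by (simp add: algebra_simps)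
  then have B0: "0 \<le> ip ?a ?b - ip (?a - ?b) (d k) - (N (d k))\<^sup>2"
    unfolding N_sq by (simp add: ip_simps) (simp add: ip_sym)
  have key: "ip (?a + ?b) (r k + g) + (N (r k + g))\<^sup>2 = ip ?\<alpha> ?\<beta> - ip ?a ?b"
    unfolding N_sq by (simp add: add_left add_right ip_sym[of "r k" "z k - \<zeta>"] ip_sym[of g "z k - \<zeta>"])
  have S: "?a + ?b = S k - y0"
    by (simp add: S_def y0_def)
  have "- ip ?a ?b \<le> - ip (?a - ?b) (d k) - (N (d k))\<^sup>2"
    using B0 by linarith
  also have "\<dots> = - ip ((?a + d k) - (?b - d k)) (d k) + (N (d k))\<^sup>2"
    unfolding N_sq by (simp add: ip_simps)
  also have "\<dots> \<le> N ((?a + d k) - (?b - d k)) * N (d k) + (N (d k))\<^sup>2"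
    using ip_Cauchy_Schwarz[of "(?a + d k) - (?b - d k)" "d k"] by linarith
  \<comment> \<open>For a pair with nonnegative inner product, the difference is no longer than the
    sum.\<close>
  also have "N ((?a + d k) - (?b - d k)) \<le> N (S k - y0)"
  proof (rule power2_le_imp_le)
    have "S k - y0 = (?a + d k) + (?b - d k)"
      by (simp add: S_def y0_def)
    moreover have "0 \<le> ip (?a + d k) (?b - d k)"
      by fact
    ultimately show "(N ((?a + d k) - (?b - d k)))\<^sup>2 \<le> (N (S k - y0))\<^sup>2"
      using N_add_sq[of "?a + d k" "?b - d k"] N_diff_sq[of "?a + d k" "?b - d k"] by simp
  qed simp
  finally have "- ip ?a ?b \<le> N (S k - y0) * N (d k) + (N (d k))\<^sup>2"
    by (simp add: mult_right_mono)
  then show ?thesis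
    using key A0 unfolding S by linarith
qed

text \<open>Relaxation costs the factor \<nu>(2 - \<nu>) in front of the squared residual, which
  stays away from 0 because \<nu> stays away from both 0 and 2.\<close>

lemma relaxed_step:
  assumes B: "(\<pi>, \<zeta>) \<in> B" and A: "(\<pi>, \<zeta>) \<in> A"
  shows "(N (S k + \<nu> k *\<^sub>R r k - (\<pi> + \<zeta>)))\<^sup>2 + \<nu>min * (2 - \<nu>max) * (N (r k))\<^sup>2
    \<le> (N (S k - (\<pi> + \<zeta>)) + 2 * N (d k))\<^sup>2"
proof -
  let ?s = "S k - (\<pi> + \<zeta>)"
  define E where "E = N ?s * N (d k) + (N (d k))\<^sup>2"
  have E: "ip ?s (r k) + (N (r k))\<^sup>2 \<le> E" "0 \<le> E"
    using key_inequality[OF B A refl, where k = k] by (simp_all add: E_def)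
  have eq: "(N (?s + \<nu> k *\<^sub>R r k))\<^sup>2 = (N ?s)\<^sup>2 + 2 * \<nu> k * (ip ?s (r k) + (N (r k))\<^sup>2) - \<nu> k * (2 - \<nu> k) * (N (r k))\<^sup>2"
    by (simp add: N_add_sq N_scaleR power_mult_distrib scaleR_right) (simp add: algebra_simps power2_eq_square)
  have "2 * \<nu> k * (ip ?s (r k) + (N (r k))\<^sup>2) \<le> 2 * \<nu> k * E"
    using E(1) \<nu>_bounds[of k] by (intro mult_left_mono) auto
  also have "2 * \<nu> k * E \<le> 4 * E"
    using \<nu>_bounds[of k] E(2) by (intro mult_right_mono) auto
  finally have "(N (?s + \<nu> k *\<^sub>R r k))\<^sup>2 + \<nu> k * (2 - \<nu> k) * (N (r k))\<^sup>2 \<le> (N ?s)\<^sup>2 + 4 * E"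
    unfolding eq by simp
  moreover have "\<nu>min * (2 - \<nu>max) * (N (r k))\<^sup>2 \<le> \<nu> k * (2 - \<nu> k) * (N (r k))\<^sup>2"
    using \<nu>min(1) \<nu>min(2)[of k] \<nu>max(1)[of k] \<nu>max(2) \<nu>_bounds[of k]
    by (intro mult_right_mono mult_mono) auto
  ultimately have "(N (?s + \<nu> k *\<^sub>R r k))\<^sup>2 + \<nu>min * (2 - \<nu>max) * (N (r k))\<^sup>2 \<le> (N ?s)\<^sup>2 + 4 * E"
    by linarith
  \<comment> \<open>The crude factor 4, from \<nu> < 2, completes the square, turning the estimate
    into an additive error for the unsquared distance.\<close>
  also have "\<dots> = (N ?s + 2 * N (d k))\<^sup>2"
    by (simp add: E_def power2_sum power_mult_distrib)
  finally show ?thesis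
    by (simp add: algebra_simps)
qed

text \<open>The point before the x-step error is added has the same limiting distance. Hence the
  difference of squares in \<open>relaxed_step\<close> tends to 0, which drives the residual to
  0.\<close>

lemma distance_convergent:
  assumes B: "(\<pi>, \<zeta>) \<in> B" and A: "(\<pi>, \<zeta>) \<in> A"
  obtains l where "(\<lambda>k. N (S k - (\<pi> + \<zeta>))) \<longlonglongrightarrow> l"
    "(\<lambda>k. N (S k + \<nu> k *\<^sub>R r k - (\<pi> + \<zeta>))) \<longlonglongrightarrow> l"
proof -
  let ?D = "\<lambda>k. N (S k - (\<pi> + \<zeta>))" and ?D' = "\<lambda>k. N (S k + \<nu> k *\<^sub>R r k - (\<pi> + \<zeta>))"
  let ?\<Delta> = "\<lambda>k. \<nu> k *\<^sub>R (u k - y k)"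
  have dist: "\<bar>?D (Suc k) - ?D' k\<bar> \<le> 2 * N (u k - y k)" for k
  proof -
    have "S (Suc k) - (\<pi> + \<zeta>) - (S k + \<nu> k *\<^sub>R r k - (\<pi> + \<zeta>)) = ?\<Delta> k"
      by (simp add: S_Suc)
    then show ?thesis
      using N_triangle_diff[of "S (Suc k) - (\<pi> + \<zeta>)" "S k + \<nu> k *\<^sub>R r k - (\<pi> + \<zeta>)"] error_bound[of k]
      by simp
  qed
  have "?D' k \<le> ?D k + 2 * N (d k)" for k
  proof (rule power2_le_imp_le)
    have "0 \<le> \<nu>min * (2 - \<nu>max) * (N (r k))\<^sup>2"
      using \<nu>min(1) \<nu>max(2) by simp
    then show "(?D' k)\<^sup>2 \<le> (?D k + 2 * N (d k))\<^sup>2"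
      using relaxed_step[OF B A, of k] by linarith
  qed simp
  then have "?D (Suc k) \<le> ?D k + (2 * N (d k) + 2 * N (u k - y k))" for k
    using dist[of k] by (smt (verit))
  then have "convergent ?D"
    by (intro perturbed_decreasing_convergent[where e = "\<lambda>k. 2 * N (d k) + 2 * N (u k - y k)"]
      summable_add summable_mult summable_d summable_u) auto
  then obtain l where l: "?D \<longlonglongrightarrow> l"
    by (auto simp: convergent_def)
  have "(\<lambda>k. ?D (Suc k) - ?D' k) \<longlonglongrightarrow> 0"
  proof (rule Lim_null_comparison)
    show "\<forall>\<^sub>F k in sequentially. norm (?D (Suc k) - ?D' k) \<le> 2 * N (u k - y k)"
      using dist by simp
    show "(\<lambda>k. 2 * N (u k - y k)) \<longlonglongrightarrow> 0"
      by (intro summable_LIMSEQ_zero summable_mult summable_u)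
  qed
  from tendsto_diff[OF LIMSEQ_Suc[OF l] this] have "?D' \<longlonglongrightarrow> l"
    by simp
  then show thesis
    using that l by blast
qed

lemma residual_tendsto:
  assumes B: "(\<pi>, \<zeta>) \<in> B" and A: "(\<pi>, \<zeta>) \<in> A"
  shows "r \<longlonglongrightarrow> 0"
proof -
  let ?D = "\<lambda>k. N (S k - (\<pi> + \<zeta>))" and ?D' = "\<lambda>k. N (S k + \<nu> k *\<^sub>R r k - (\<pi> + \<zeta>))"
  obtain l where l: "?D \<longlonglongrightarrow> l" "?D' \<longlonglongrightarrow> l"
    using distance_convergent[OF B A] by blast
  define \<gamma> where "\<gamma> = \<nu>min * (2 - \<nu>max)"
  have \<gamma>: "\<gamma> > 0"
    using \<nu>min(1) \<nu>max(2) by (simp add: \<gamma>_def)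
  have "(\<lambda>k. ((?D k + 2 * N (d k))\<^sup>2 - (?D' k)\<^sup>2) / \<gamma>) \<longlonglongrightarrow> ((l + 2 * 0)\<^sup>2 - l\<^sup>2) / \<gamma>"
    by (intro tendsto_intros l d_tendsto) (use \<gamma> in simp)
  moreover have "(N (r k))\<^sup>2 \<le> ((?D k + 2 * N (d k))\<^sup>2 - (?D' k)\<^sup>2) / \<gamma>" for k
    using relaxed_step[OF B A, of k] \<gamma> by (simp add: \<gamma>_def[symmetric] field_simps)
  ultimately have "(\<lambda>k. (N (r k))\<^sup>2) \<longlonglongrightarrow> 0"
    by (intro tendsto_sandwich[of "\<lambda>_. 0" "\<lambda>k. (N (r k))\<^sup>2" sequentially
      "\<lambda>k. ((?D k + 2 * N (d k))\<^sup>2 - (?D' k)\<^sup>2) / \<gamma>"]) auto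
  then have "(\<lambda>k. sqrt ((N (r k))\<^sup>2)) \<longlonglongrightarrow> sqrt 0"
    by (rule tendsto_real_sqrt)
  then show ?thesis
    by (simp add: tendsto_iff_N[of r])
qed

lemma d_tendsto_0: "d \<longlonglongrightarrow> 0"
  using d_tendsto by (simp add: tendsto_iff_N[of d])

text \<open>An Opial argument: a cluster pair is itself a zero, so the distance of S to its sum
  converges as well, and along the subsequence that distance tends to 0.\<close>

theorem convergence:
  assumes B: "(\<pi>, \<zeta>) \<in> B" and A: "(\<pi>, \<zeta>) \<in> A"
  obtains p' z' where "P \<longlonglongrightarrow> p'" "z \<longlonglongrightarrow> z'" "u \<longlonglongrightarrow> z'" "(p', z') \<in> A" "(p', z') \<in> B"
proof -
  obtain l where l: "(\<lambda>k. N (S k - (\<pi> + \<zeta>))) \<longlonglongrightarrow> l"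
    using distance_convergent[OF B A] by blast
  then obtain C where "\<And>k. \<bar>N (S k - (\<pi> + \<zeta>))\<bar> \<le> C"
    using convergent_imp_Bseq[of "\<lambda>k. N (S k - (\<pi> + \<zeta>))"] by (auto simp: convergent_def Bseq_def)
  then have C: "N (S k - (\<pi> + \<zeta>)) \<le> C" for k
    by (simp add: abs_le_iff)
  have "bounded (range (\<lambda>k. P k + d k - \<pi>))" "bounded (range (\<lambda>k. z k - d k - \<zeta>))"
    unfolding bounded_iff_N using resolvent_nonexpansive[OF B] C order_trans by metis+
  then have "bounded (range (\<lambda>k. (P k + d k - \<pi>, z k - d k - \<zeta>)))"
    by (rule bounded_subset[OF bounded_Times]) auto
  then obtain w \<sigma> where \<sigma>: "strict_mono \<sigma>"
    and w: "((\<lambda>k. (P k + d k - \<pi>, z k - d k - \<zeta>)) \<circ> \<sigma>) \<longlonglongrightarrow> w"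
    using bounded_imp_convergent_subsequence by blast
  define p' where "p' = fst w + \<pi>"
  define z' where "z' = snd w + \<zeta>"
  have dlim: "(\<lambda>k. d (\<sigma> k)) \<longlonglongrightarrow> 0" and rlim: "(\<lambda>k. r (\<sigma> k)) \<longlonglongrightarrow> 0"
    using LIMSEQ_subseq_LIMSEQ[OF d_tendsto_0 \<sigma>] LIMSEQ_subseq_LIMSEQ[OF residual_tendsto[OF B A] \<sigma>]
    by (simp_all add: o_def)
  have p1: "(\<lambda>k. P (\<sigma> k) + d (\<sigma> k)) \<longlonglongrightarrow> p'"
    using tendsto_add[OF tendsto_fst[OF w] tendsto_const[of \<pi>]] by (simp add: o_def p'_def)
  have z1: "(\<lambda>k. z (\<sigma> k) - d (\<sigma> k)) \<longlonglongrightarrow> z'"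
    using tendsto_add[OF tendsto_snd[OF w] tendsto_const[of \<zeta>]] by (simp add: o_def z'_def)
  have p2: "(\<lambda>k. P (\<sigma> k)) \<longlonglongrightarrow> p'"
    using tendsto_diff[OF p1 dlim] by simp
  have z2: "(\<lambda>k. z (\<sigma> k)) \<longlonglongrightarrow> z'"
    using tendsto_add[OF z1 dlim] by simp
  have y2: "(\<lambda>k. y (\<sigma> k)) \<longlonglongrightarrow> z'"
    using tendsto_add[OF z2 rlim] by (simp add: r_def)
  have "(\<lambda>k. P (\<sigma> k) + (y (\<sigma> k) - z (\<sigma> k))) \<longlonglongrightarrow> p'"
    using tendsto_add[OF p2 rlim] by (simp add: r_def)
  then have A': "(p', z') \<in> A"
    using closed_sequentially[OF closed_A, of "\<lambda>k. (P (\<sigma> k) + (y (\<sigma> k) - z (\<sigma> k)), y (\<sigma> k))"]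
      tendsto_Pair[OF _ y2] in_A by blast
  have B': "(p', z') \<in> B"
    using closed_sequentially[OF closed_B, of "\<lambda>k. (P (\<sigma> k) + d (\<sigma> k), z (\<sigma> k) - d (\<sigma> k))"]
      tendsto_Pair[OF p1 z1] in_B by blast
  obtain l' where l': "(\<lambda>k. N (S k - (p' + z'))) \<longlonglongrightarrow> l'"
    using distance_convergent[OF B' A'] by blast
  have "(\<lambda>k. S (\<sigma> k)) \<longlonglongrightarrow> p' + z'"
    unfolding S_def by (intro tendsto_add p2 z2)
  then have "(\<lambda>k. N (S (\<sigma> k) - (p' + z'))) \<longlonglongrightarrow> 0"
    by (simp add: tendsto_iff_N[of "\<lambda>k. S (\<sigma> k)"])
  moreover have "(\<lambda>k. N (S (\<sigma> k) - (p' + z'))) \<longlonglongrightarrow> l'"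
    using LIMSEQ_subseq_LIMSEQ[OF l' \<sigma>] by (simp add: o_def)
  ultimately have "l' = 0"
    using LIMSEQ_unique by blast
  then have S0: "(\<lambda>k. N (S k - (p' + z'))) \<longlonglongrightarrow> 0"
    using l' by simp
  \<comment> \<open>Convergence of S controls only a sum; nonexpansiveness of the resolvent recovers
    each component.\<close>
  have "(\<lambda>k. N (P k + d k - p')) \<longlonglongrightarrow> 0"
    by (rule tendsto_sandwich[OF _ _ tendsto_const S0]) (simp_all add: resolvent_nonexpansive[OF B'])
  then have "(\<lambda>k. P k + d k) \<longlonglongrightarrow> p'"
    by (simp add: tendsto_iff_N[of "\<lambda>k. P k + d k"])
  from tendsto_diff[OF this d_tendsto_0] have Plim: "P \<longlonglongrightarrow> p'"
    by simp
  have "(\<lambda>k. N (z k - d k - z')) \<longlonglongrightarrow> 0"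
    by (rule tendsto_sandwich[OF _ _ tendsto_const S0]) (simp_all add: resolvent_nonexpansive[OF B'])
  then have "(\<lambda>k. z k - d k) \<longlonglongrightarrow> z'"
    by (simp add: tendsto_iff_N[of "\<lambda>k. z k - d k"])
  from tendsto_add[OF this d_tendsto_0] have zlim: "z \<longlonglongrightarrow> z'"
    by simp
  have "(\<lambda>k. u k - y k) \<longlonglongrightarrow> 0"
    using summable_LIMSEQ_zero[OF summable_u] by (simp add: tendsto_iff_N[of "\<lambda>k. u k - y k"])
  from tendsto_add[OF tendsto_add[OF zlim residual_tendsto[OF B A]] this]
  have "u \<longlonglongrightarrow> z'"
    by (simp add: r_def)
  then show thesis
    using that Plim zlim A' B' by blast
qed

end

section \<open>Bounded orbits produce zeros\<close>

context inexact_splitting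
begin

text \<open>Expanding |r + g|^2 in \<open>key_inequality\<close> produces a cross term <r, g> of
  unknown sign. As S advances by \<nu> r up to an error, the linear part 4 <S, g> of
  \<open>V\<close> cancels it, and |r|^2 absorbs the quadratic term of the step since \<nu> < 2.
  What remains besides the errors is the drift.\<close>

lemma ergodic_step:
  assumes B: "(\<pi>, \<zeta>) \<in> B" and A: "(\<kappa>, \<eta>) \<in> A" and eq: "\<kappa> - \<eta> = \<pi> - \<zeta>"
    and C: "N (S k - (\<pi> + \<zeta>)) \<le> C" "N (S (Suc k) - (\<pi> + \<zeta>)) \<le> C" "N (d k) \<le> C"
  defines "V \<equiv> \<lambda>k. (N (S k - (\<pi> + \<zeta>)))\<^sup>2 + 4 * ip (S k) (\<pi> - \<kappa>)"
  shows "V (Suc k) - V k + 2 * \<nu> k * (ip (S k - (\<pi> + \<zeta>)) (\<pi> - \<kappa>) + (N (\<pi> - \<kappa>))\<^sup>2)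
    \<le> 8 * C * N (d k) + (4 * C + 8 * N (\<pi> - \<kappa>)) * N (u k - y k)"
proof -
  define g where "g = \<pi> - \<kappa>"
  let ?s = "S k - (\<pi> + \<zeta>)" and ?s' = "S (Suc k) - (\<pi> + \<zeta>)" and ?\<Delta> = "\<nu> k *\<^sub>R (u k - y k)"
  let ?e = "N (u k - y k)"
  have \<nu>: "0 < \<nu> k" "\<nu> k < 2"
    using \<nu>_bounds by auto
  have C0: "0 \<le> C"
    using C(3) N_nonneg order_trans by blast
  have key: "ip ?s (r k) + ip ?s g + (N (r k + g))\<^sup>2 \<le> 2 * C * N (d k)"
  proof -
    have "ip ?s (r k + g) + (N (r k + g))\<^sup>2 \<le> N ?s * N (d k) + (N (d k))\<^sup>2"
      unfolding g_def by (rule key_inequality[OF B A eq])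
    also have "\<dots> \<le> C * N (d k) + C * N (d k)"
      unfolding power2_eq_square using C by (intro add_mono mult_right_mono) auto
    finally show ?thesis
      by (simp add: add_right)
  qed
  have "2 * \<nu> k * (ip ?s (r k) + ip ?s g + (N (r k + g))\<^sup>2) \<le> 2 * \<nu> k * (2 * C * N (d k))"
    using key \<nu> by (intro mult_left_mono) auto
  also have "\<dots> \<le> 4 * (2 * C * N (d k))"
    using \<nu> C0 by (intro mult_right_mono) auto
  finally have key2: "2 * \<nu> k * ip ?s (r k) \<le> 8 * C * N (d k) - 2 * \<nu> k * ip ?s g
      - 2 * \<nu> k * (N (r k))\<^sup>2 - 4 * \<nu> k * ip (r k) g - 2 * \<nu> k * (N g)\<^sup>2"
    by (simp add: N_add_sq ip_sym[of g "r k"] algebra_simps)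
  have "(N (?s + \<nu> k *\<^sub>R r k))\<^sup>2 = (N ?s)\<^sup>2 + 2 * \<nu> k * ip ?s (r k) + \<nu> k * \<nu> k * (N (r k))\<^sup>2"
    by (simp add: N_add_sq N_scaleR power_mult_distrib scaleR_right) (simp add: power2_eq_square)
  moreover have "\<nu> k * \<nu> k * (N (r k))\<^sup>2 \<le> 2 * \<nu> k * (N (r k))\<^sup>2"
    using \<nu> by (intro mult_right_mono) auto
  ultimately have X: "(N (?s + \<nu> k *\<^sub>R r k))\<^sup>2 \<le> (N ?s)\<^sup>2 + 8 * C * N (d k) - 2 * \<nu> k * ip ?s g
      - 4 * \<nu> k * ip (r k) g - 2 * \<nu> k * (N g)\<^sup>2"
    using key2 by linarith
  have "ip ?s' ?\<Delta> \<le> C * (2 * ?e)"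
  proof -
    have "ip ?s' ?\<Delta> \<le> N ?s' * N ?\<Delta>"
      using ip_Cauchy_Schwarz[of ?s' ?\<Delta>] by linarith
    also have "\<dots> \<le> C * (2 * ?e)"
      using C(2) error_bound[of k] C0 by (intro mult_mono) auto
    finally show ?thesis .
  qed
  \<comment> \<open>The square is expanded around the new iterate, for which the bound
    \<open>C\<close> is assumed, rather than around the intermediate point.\<close>
  moreover have shift: "?s + \<nu> k *\<^sub>R r k = ?s' - ?\<Delta>"
    by (simp add: S_Suc)
  ultimately have X': "(N ?s')\<^sup>2 \<le> (N (?s + \<nu> k *\<^sub>R r k))\<^sup>2 + 4 * C * ?e"
    using zero_le_power2[of "N ?\<Delta>"] unfolding shift N_diff_sq by linarith
  have "ip ?\<Delta> g \<le> 2 * ?e * N g"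
  proof -
    have "ip ?\<Delta> g \<le> N ?\<Delta> * N g"
      using ip_Cauchy_Schwarz[of ?\<Delta> g] by linarith
    also have "\<dots> \<le> 2 * ?e * N g"
      using error_bound[of k] by (intro mult_right_mono) auto
    finally show ?thesis .
  qed
  moreover have "ip (S (Suc k)) g = ip (S k) g + \<nu> k * ip (r k) g + ip ?\<Delta> g"
    unfolding S_Suc by (simp add: add_left scaleR_left)
  ultimately have "4 * ip (S (Suc k)) g \<le> 4 * ip (S k) g + 4 * \<nu> k * ip (r k) g + 8 * N g * ?e"
    by (simp add: algebra_simps)
  then show ?thesis
    using X X' unfolding V_def g_def[symmetric] by (simp add: algebra_simps)
qed

theorem zero_exists_if_bounded:
  assumes bdd: "bounded (range P)" "bounded (range z)"
    and resolvent_B: "\<And>s. \<exists>\<pi> \<zeta>. (\<pi>, \<zeta>) \<in> B \<and> \<pi> + \<zeta> = s"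
    and resolvent_A: "\<And>t. \<exists>\<kappa> \<eta>. (\<kappa>, \<eta>) \<in> A \<and> \<kappa> - \<eta> = t"
  shows "\<exists>\<pi> \<zeta>. (\<pi>, \<zeta>) \<in> A \<and> (\<pi>, \<zeta>) \<in> B"
proof -
  define \<Lambda> where "\<Lambda> n = (\<Sum>k<n. \<nu> k)" for n
  define \<sigma> where "\<sigma> n = (\<Sum>k<n. \<nu> k *\<^sub>R S k) /\<^sub>R \<Lambda> n" for n
  obtain b1 b2 where b: "\<And>k. norm (P k) \<le> b1" "\<And>k. norm (z k) \<le> b2"
    using bdd by (auto simp: bounded_iff)
  have normS: "norm (S k) \<le> b1 + b2" for k
    unfolding S_def by (rule norm_triangle_mono[OF b])
  then have bddS: "bounded (range S)"
    by (auto simp: bounded_iff)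
  have \<Lambda>_ge: "real n * \<nu>min \<le> \<Lambda> n" for n
    unfolding \<Lambda>_def using sum_bounded_below[of "{..<n}" \<nu>min \<nu>] \<nu>min by simp
  have \<Lambda>_nonneg: "0 \<le> \<Lambda> n" for n
    unfolding \<Lambda>_def using \<nu>_bounds by (simp add: sum_nonneg less_imp_le)
  have "norm (\<sigma> n) \<le> b1 + b2" for n
  proof (cases "\<Lambda> n = 0")
    case False
    then have pos: "\<Lambda> n > 0"
      using \<Lambda>_nonneg[of n] by simp
    have "norm (\<Sum>k<n. \<nu> k *\<^sub>R S k) \<le> (\<Sum>k<n. \<nu> k * (b1 + b2))"
      using \<nu>_bounds normS by (intro sum_norm_le) (simp add: mult_left_mono less_imp_le)
    then have "norm (\<Sum>k<n. \<nu> k *\<^sub>R S k) \<le> \<Lambda> n * (b1 + b2)"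
      by (simp add: \<Lambda>_def sum_distrib_right)
    then show ?thesis
      using pos by (simp add: \<sigma>_def field_simps)
  next
    \<comment> \<open>This happens only for n = 0, where inverse 0 = 0 makes the average 0.\<close>
    case True
    then show ?thesis
      using order_trans[OF norm_ge_zero normS] by (simp add: \<sigma>_def)
  qed
  then have "bounded (range \<sigma>)"
    by (auto simp: bounded_iff)
  then obtain s \<tau> where \<tau>: "strict_mono \<tau>" and s: "(\<sigma> \<circ> \<tau>) \<longlonglongrightarrow> s"
    using bounded_imp_convergent_subsequence by blast
  \<comment> \<open>The comparison pairs are fixed only after \<open>s\<close>, so that the averages
    tend to the comparison point along \<tau>.\<close>
  obtain \<pi> \<zeta> where B: "(\<pi>, \<zeta>) \<in> B" and \<pi>\<zeta>: "\<pi> + \<zeta> = s"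
    using resolvent_B by blast
  obtain \<kappa> \<eta> where A: "(\<kappa>, \<eta>) \<in> A" and eq: "\<kappa> - \<eta> = \<pi> - \<zeta>"
    using resolvent_A by blast
  define g where "g = \<pi> - \<kappa>"
  have "bounded (range (\<lambda>k. S k - s))"
    unfolding bounded_iff using order_trans[OF norm_triangle_ineq4 add_right_mono[OF normS]] by blast
  then obtain C1 where C1: "\<And>k. N (S k - s) \<le> C1"
    unfolding bounded_iff_N by blast
  obtain C2 where C2: "\<And>k. N (S k) \<le> C2"
    using bddS unfolding bounded_iff_N by blast
  obtain C3 where C3: "\<And>k. N (d k) \<le> C3"
    using convergent_imp_bounded[OF d_tendsto_0] unfolding bounded_iff_N by blast
  define C where "C = max C1 C3"
  have C: "N (S k - s) \<le> C" "N (d k) \<le> C" for k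
    using C1[of k] C3[of k] by (auto simp: C_def)
  define V where "V k = (N (S k - s))\<^sup>2 + 4 * ip (S k) g" for k
  define e where "e k = 8 * C * N (d k) + (4 * C + 8 * N g) * N (u k - y k)" for k
  have step_le: "V (Suc k) - V k + 2 * \<nu> k * (ip (S k - s) g + (N g)\<^sup>2) \<le> e k" for k
    unfolding V_def e_def g_def \<pi>\<zeta>[symmetric]
    by (rule ergodic_step[OF B A eq]) (use C in \<open>simp_all add: \<pi>\<zeta>\<close>)
  have "summable e"
    unfolding e_def by (intro summable_add summable_mult summable_d summable_u)
  have e_nonneg: "0 \<le> e k" for k
    using order_trans[OF N_nonneg C(2)] by (simp add: e_def)
  have sum_le: "V n - V 0 + 2 * (ip (\<Sum>k<n. \<nu> k *\<^sub>R S k) g - \<Lambda> n * ip s g + \<Lambda> n * (N g)\<^sup>2) \<le> sum e {..<n}" for n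
  proof (induction n)
    case (Suc n)
    then show ?case
      using step_le[of n] by (simp add: \<Lambda>_def add_left scaleR_left diff_left algebra_simps)
  qed (simp add: \<Lambda>_def zero_left)
  \<comment> \<open>Bounds the telescoped sum for all n at once; the last summand comes from
    \<open>V n\<close> being at least 4 <S n, g>.\<close>
  define K where "K = suminf e + V 0 + 4 * C2 * N g"
  have bound: "ip (\<sigma> n - s) g + (N g)\<^sup>2 \<le> K / (2 * \<Lambda> n)" if n: "n > 0" for n
  proof -
    have pos: "\<Lambda> n > 0"
      using \<Lambda>_ge[of n] \<nu>min(1) n by (smt (verit) mult_pos_pos of_nat_0_less_iff)
    have "sum e {..<n} \<le> suminf e"
      using \<open>summable e\<close> e_nonneg by (intro sum_le_suminf) auto
    moreover have "- (C2 * N g) \<le> ip (S n) g"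
    proof -
      have "\<bar>ip (S n) g\<bar> \<le> C2 * N g"
        by (rule order_trans[OF ip_Cauchy_Schwarz]) (intro mult_right_mono C2 N_nonneg)
      then show ?thesis
        by linarith
    qed
    then have "- (4 * C2 * N g) \<le> V n"
      unfolding V_def using zero_le_power2[of "N (S n - s)"] by linarith
    ultimately have "2 * (ip (\<Sum>k<n. \<nu> k *\<^sub>R S k) g - \<Lambda> n * ip s g + \<Lambda> n * (N g)\<^sup>2) \<le> K"
      using sum_le[of n] by (simp add: K_def)
    moreover have "ip (\<Sum>k<n. \<nu> k *\<^sub>R S k) g = \<Lambda> n * ip (\<sigma> n) g"
      using pos by (simp add: \<sigma>_def scaleR_left)
    ultimately have "2 * \<Lambda> n * (ip (\<sigma> n - s) g + (N g)\<^sup>2) \<le> K"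
      by (simp add: diff_left algebra_simps)
    then show ?thesis
      using pos by (simp add: field_simps)
  qed
  have "filterlim (\<lambda>n. real n * \<nu>min) at_top sequentially"
    by (intro filterlim_at_top_mult_tendsto_pos[OF tendsto_const \<nu>min(1)] filterlim_real_sequentially)
  then have "filterlim \<Lambda> at_top sequentially"
    by (rule filterlim_at_top_mono) (use \<Lambda>_ge in simp)
  then have "filterlim (\<lambda>n. 2 * \<Lambda> n) at_top sequentially"
    by (intro filterlim_tendsto_pos_mult_at_top[OF tendsto_const]) auto
  then have "(\<lambda>n. K / (2 * \<Lambda> n)) \<longlonglongrightarrow> 0"
    by (intro tendsto_divide_0[OF tendsto_const] filterlim_at_top_imp_at_infinity)
  from LIMSEQ_subseq_LIMSEQ[OF this \<tau>]
  have lim1: "(\<lambda>n. K / (2 * \<Lambda> (\<tau> n))) \<longlonglongrightarrow> 0"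
    by (simp add: o_def)
  have lim2: "(\<lambda>n. ip (\<sigma> (\<tau> n) - s) g + (N g)\<^sup>2) \<longlonglongrightarrow> ip (s - s) g + (N g)\<^sup>2"
    using s by (intro tendsto_intros tendsto) (simp_all add: o_def)
  have "ip (s - s) g + (N g)\<^sup>2 \<le> 0"
  proof (rule LIMSEQ_le[OF lim2 lim1], intro exI allI impI)
    fix n :: nat assume "1 \<le> n"
    then have "0 < \<tau> n"
      using seq_suble[OF \<tau>, of n] by linarith
    then show "ip (\<sigma> (\<tau> n) - s) g + (N g)\<^sup>2 \<le> K / (2 * \<Lambda> (\<tau> n))"
      by (rule bound)
  qed
  then have "g = 0"
    by (simp add: zero_left N_eq_0_iff)
  then have "\<kappa> = \<pi>" "\<eta> = \<zeta>"
    using eq by (simp_all add: g_def)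
  then show ?thesis
    using A B by blast
qed

end

section \<open>The method of multipliers as a splitting\<close>

lemma weighted_norm_sq:
  assumes "symmetric_pos_def W"
  shows "(weighted_norm W u)\<^sup>2 = u \<bullet> (W *v u)"
proof -
  have "0 \<le> u \<bullet> (W *v u)"
    using assms by (cases "u = 0") (auto simp: symmetric_pos_def_def less_imp_le)
  then show ?thesis
    by (simp add: weighted_norm_def)
qed

lemma quadratic_expansion:
  assumes W: "symmetric_pos_def W"
  shows "(weighted_norm W (a + t *\<^sub>R b))\<^sup>2
    = (weighted_norm W a)\<^sup>2 + t * (2 * ((W *v a) \<bullet> b)) + t\<^sup>2 * (weighted_norm W b)\<^sup>2"
  unfolding weighted_norm_sq[OF W]
  using symmetric_pos_def_swap[OF W, of a b]
  by (simp add: matrix_vector_right_distrib matrix_vector_mult_scaleR inner_add_left inner_add_right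
      inner_commute[of b "W *v a"] power2_eq_square distrib_left)

lemma symmetric_pos_def_scaleR:
  assumes "symmetric_pos_def W" "0 < c"
  shows "symmetric_pos_def (c *\<^sub>R W)"
  using assms unfolding symmetric_pos_def_def
  by (simp add: scaleR_matrix_vector_assoc[symmetric] transpose_scalar)

lemma symmetric_pos_def_inverse:
  fixes G :: "real^'m^'m"
  assumes G: "symmetric_pos_def G"
  obtains H where "symmetric_pos_def H" "\<And>u. G *v (H *v u) = u" "\<And>u. H *v (G *v u) = u"
proof -
  have "\<forall>u. G *v u = 0 \<longrightarrow> u = 0"
    using G unfolding symmetric_pos_def_def by (metis inner_zero_right less_irrefl)
  then obtain H where H: "H ** G = mat 1"
    using matrix_left_invertible_ker by blast
  then have H': "G ** H = mat 1"
    by (simp add: matrix_left_right_inverse)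
  have GH: "G *v (H *v u) = u" and HG: "H *v (G *v u) = u" for u
    by (simp_all add: matrix_vector_mul_assoc H H')
  have "transpose H ** G = mat 1"
    using H' G by (metis matrix_transpose_mul symmetric_pos_def_def transpose_mat)
  then have "transpose H = H"
    using H' by (metis matrix_mul_assoc matrix_mul_lid matrix_mul_rid)
  moreover have "0 < u \<bullet> (H *v u)" if "u \<noteq> 0" for u
  proof -
    have "H *v u \<noteq> 0"
      using GH[of u] that by auto
    then have "0 < (H *v u) \<bullet> (G *v (H *v u))"
      using G by (simp add: symmetric_pos_def_def)
    then show ?thesis
      by (simp add: GH inner_commute)
  qed
  ultimately show thesis
    using that[of H] GH HG by (simp add: symmetric_pos_def_def)
qed

section \<open>Optimality conditions for the primal and dual problems and the two
  subproblems\<close>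

lemma minimizesD: "minimizes h x \<Longrightarrow> h x \<le> h y"
  by (auto simp: minimizes_def is_arg_min_def not_less)

lemma minimizesI: "(\<And>y. h x \<le> h y) \<Longrightarrow> minimizes h x"
  by (auto simp: minimizes_def is_arg_min_def not_less)

lemma dual_objective_eq:
  "dual_objective f g M q = (convex_conjugate f \<circ> (\<lambda>q. - (transpose M *v q))) q + convex_conjugate g q"
  by (simp add: dual_objective_def)

lemma minimizes_dual_objective:
  assumes "z \<in> subdifferential (convex_conjugate g) p"
    and "- z \<in> subdifferential (convex_conjugate f \<circ> (\<lambda>q. - (transpose M *v q))) p"
  shows "minimizes (dual_objective f g M) p"
proof (rule minimizesI)
  fix q
  let ?h = "convex_conjugate f \<circ> (\<lambda>q. - (transpose M *v q))"
  have "(?h p + ereal (- z \<bullet> (q - p))) + (convex_conjugate g p + ereal (z \<bullet> (q - p)))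
    \<le> ?h q + convex_conjugate g q"
    using assms by (intro add_mono) (auto simp: subdifferential_def)
  moreover have "(a + ereal (- t)) + (b + ereal t) = a + b" for a b :: ereal and t
    by (cases a; cases b) auto
  ultimately show "dual_objective f g M p \<le> dual_objective f g M q"
    unfolding dual_objective_eq by simp
qed

lemma minimizes_primal_objective:
  assumes "- (transpose M *v p) \<in> subdifferential f x" and "p \<in> subdifferential g (M *v x)"
  shows "minimizes (primal_objective f g M) x"
proof (rule minimizesI)
  fix u
  have "(transpose M *v p) \<bullet> (u - x) = p \<bullet> (M *v u - M *v x)"
    by (simp add: dot_lmul_matrix matrix_vector_mult_diff_distrib)
  moreover have "f x + ereal (- (transpose M *v p) \<bullet> (u - x)) \<le> f u"
    using assms(1) unfolding subdifferential_def by blast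
  ultimately have "f x + ereal (- (p \<bullet> (M *v u - M *v x))) \<le> f u"
    by (simp only: inner_minus_left)
  moreover have "g (M *v x) + ereal (p \<bullet> (M *v u - M *v x)) \<le> g (M *v u)"
    using assms(2) unfolding subdifferential_def by blast
  ultimately have "(f x + ereal (- (p \<bullet> (M *v u - M *v x)))) + (g (M *v x) + ereal (p \<bullet> (M *v u - M *v x)))
    \<le> f u + g (M *v u)"
    by (rule add_mono)
  moreover have "(a + ereal (- t)) + (b + ereal t) = a + b" for a b :: ereal and t
    by (cases a; cases b) auto
  ultimately show "primal_objective f g M x \<le> primal_objective f g M u"
    unfolding primal_objective_def by simp
qed

lemma Fenchel_equality_subgradient:
  assumes eq: "f x = ereal a" "convex_conjugate f s = ereal (s \<bullet> x - a)"
  shows "x \<in> subdifferential (convex_conjugate f) s"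
  unfolding subdifferential_def
proof (intro CollectI allI)
  fix t
  have "convex_conjugate f s + ereal (x \<bullet> (t - s)) = ereal (t \<bullet> x) - f x"
    by (simp add: eq inner_diff_right inner_commute)
  then show "convex_conjugate f s + ereal (x \<bullet> (t - s)) \<le> convex_conjugate f t"
    using conjugate_ge[of t x f] by simp
qed

text \<open>The products in the two Fenchel inequalities cancel, so a zero sum of the four values
  forces equality in each inequality.\<close>

lemma strong_duality_subgradients:
  assumes f: "closed_proper_convex f" and g: "closed_proper_convex g" and sd: "strong_duality f g M"
  obtains x p where "x \<in> subdifferential (convex_conjugate f) (- (transpose M *v p))"
    "M *v x \<in> subdifferential (convex_conjugate g) p"
proof -
  obtain x p where sum: "primal_objective f g M x + dual_objective f g M p = 0"
    using sd by (auto simp: strong_duality_def)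
  let ?s = "- (transpose M *v p)"
  have nm: "\<And>u. f u \<noteq> -\<infinity>" "\<And>u. g u \<noteq> -\<infinity>"
    and "\<exists>u. f u \<noteq> \<infinity>" "\<exists>u. g u \<noteq> \<infinity>"
    using f g by (auto simp: closed_proper_convex_def)
  then have nmc: "convex_conjugate f ?s \<noteq> -\<infinity>" "convex_conjugate g p \<noteq> -\<infinity>"
    using conjugate_not_MInf by blast+
  obtain a b a' b' where real: "f x = ereal a" "g (M *v x) = ereal b"
    "convex_conjugate f ?s = ereal a'" "convex_conjugate g p = ereal b'"
    using sum nm(1)[of x] nm(2)[of "M *v x"] nmc unfolding primal_objective_def dual_objective_def
    by (cases "f x"; cases "g (M *v x)"; cases "convex_conjugate f ?s"; cases "convex_conjugate g p") auto
  have "a + b + (a' + b') = 0"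
    using sum unfolding primal_objective_def dual_objective_def real by simp
  moreover have "?s \<bullet> x - a \<le> a'" "p \<bullet> (M *v x) - b \<le> b'"
    using conjugate_ge[of ?s x f] conjugate_ge[of p "M *v x" g] by (simp_all only: real) simp_all
  moreover have "?s \<bullet> x = - (p \<bullet> (M *v x))"
    by (simp add: dot_lmul_matrix)
  ultimately have eq: "a' = ?s \<bullet> x - a" "b' = p \<bullet> (M *v x) - b"
    by linarith+
  show thesis
    using that Fenchel_equality_subgradient[of f, OF real(1), of ?s]
      Fenchel_equality_subgradient[of g, OF real(2), of p] real(3,4) unfolding eq by blast
qed

lemma subdifferential_comp:
  fixes M :: "real^'n^'m"
  assumes "x \<in> subdifferential h (- (transpose M *v p))"
  shows "- (M *v x) \<in> subdifferential (h \<circ> (\<lambda>q. - (transpose M *v q))) p"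
  unfolding subdifferential_def
proof (intro CollectI allI)
  fix q
  have "x \<bullet> (- (transpose M *v q) - - (transpose M *v p)) = - (M *v x) \<bullet> (q - p)"
    by (simp add: inner_diff_right inner_commute[of x] inner_commute[of "M *v x"] dot_lmul_matrix)
  moreover have "h (- (transpose M *v p)) + ereal (x \<bullet> (- (transpose M *v q) - - (transpose M *v p)))
      \<le> h (- (transpose M *v q))"
    using assms unfolding subdifferential_def by blast
  ultimately show "(h \<circ> (\<lambda>q. - (transpose M *v q))) p + ereal (- (M *v x) \<bullet> (q - p))
      \<le> (h \<circ> (\<lambda>q. - (transpose M *v q))) q"
    by (simp del: transpose_matrix_vector)
qed

text \<open>The gradient of the linear and quadratic terms yields the provisional multiplier p +
  cW(Mx - z), formed with the old \<open>z\<close> and without relaxation. It becomes the first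
  component of the pair in A.\<close>

lemma x_step_subgradient:
  fixes f :: "real^'n \<Rightarrow> ereal" and M :: "real^'n^'m" and W :: "real^'m^'m"
  assumes f: "closed_proper_convex f" and W: "symmetric_pos_def W"
    and min: "minimizes (\<lambda>u. f u + ereal (p \<bullet> (M *v u)) + ereal (c / 2 * (weighted_norm W (M *v u - z))\<^sup>2)) x"
  shows "- (transpose M *v (p + c *\<^sub>R (W *v (M *v x - z)))) \<in> subdifferential f x"
proof (rule minimizer_subgradient[OF f])
  let ?q = "\<lambda>u. p \<bullet> (M *v u) + c / 2 * (weighted_norm W (M *v u - z))\<^sup>2"
  show "f x + ereal (?q x) \<le> f w + ereal (?q w)" for w
    using minimizesD[OF min, of w] by (simp add: add.assoc)
  fix w t
  have "M *v (x + t *\<^sub>R (w - x)) - z = (M *v x - z) + t *\<^sub>R (M *v (w - x))"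
    by (simp add: matrix_vector_right_distrib matrix_vector_mult_scaleR)
  moreover have "(transpose M *v (p + c *\<^sub>R (W *v (M *v x - z)))) \<bullet> (w - x)
      = p \<bullet> (M *v (w - x)) + c * ((W *v (M *v x - z)) \<bullet> (M *v (w - x)))"
    by (simp add: dot_lmul_matrix inner_add_left)
  moreover have "p \<bullet> (M *v (x + t *\<^sub>R (w - x))) = p \<bullet> (M *v x) + t * (p \<bullet> (M *v (w - x)))"
    by (simp add: matrix_vector_right_distrib matrix_vector_mult_scaleR inner_add_right)
  ultimately show "?q (x + t *\<^sub>R (w - x)) = ?q x
      + t * ((transpose M *v (p + c *\<^sub>R (W *v (M *v x - z)))) \<bullet> (w - x))
      + t\<^sup>2 * (c / 2 * (weighted_norm W (M *v (w - x)))\<^sup>2)"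
    by (simp only: quadratic_expansion[OF W]) (simp add: algebra_simps)
qed

lemma z_step_subgradient:
  fixes g :: "real^'m \<Rightarrow> ereal" and W :: "real^'m^'m"
  assumes g: "closed_proper_convex g" and W: "symmetric_pos_def W"
    and min: "minimizes (\<lambda>u. g u - ereal (p \<bullet> u) + ereal (c / 2 * (weighted_norm W (a - u))\<^sup>2)) v"
  shows "p + c *\<^sub>R (W *v (a - v)) \<in> subdifferential g v"
proof -
  let ?q = "\<lambda>u. - (p \<bullet> u) + c / 2 * (weighted_norm W (a - u))\<^sup>2"
  have "- (- p - c *\<^sub>R (W *v (a - v))) \<in> subdifferential g v"
  proof (rule minimizer_subgradient[OF g])
    have "g u - ereal (p \<bullet> u) + ereal s = g u + ereal (- (p \<bullet> u) + s)" for u s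
      by (cases "g u") auto
    then show "g v + ereal (?q v) \<le> g w + ereal (?q w)" for w
      using minimizesD[OF min, of w] by simp
    fix w t
    have "a - (v + t *\<^sub>R (w - v)) = (a - v) + t *\<^sub>R (v - w)"
      by (simp add: algebra_simps)
    then show "?q (v + t *\<^sub>R (w - v)) = ?q v + t * ((- p - c *\<^sub>R (W *v (a - v))) \<bullet> (w - v))
      + t\<^sup>2 * (c / 2 * (weighted_norm W (v - w))\<^sup>2)"
      by (simp only: quadratic_expansion[OF W])
        (simp add: inner_add_right inner_diff_right inner_diff_left algebra_simps)
  qed
  then show ?thesis
    by (simp add: add.commute)
qed

lemma closed_subdifferential_relation:
  fixes h :: "real^'m \<Rightarrow> ereal"
  assumes h: "closed_proper_convex h"
  shows "closed {(\<kappa>, \<eta>). a *\<^sub>R \<eta> \<in> subdifferential h (G *v \<kappa>)}"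
  unfolding closed_sequential_limits
proof (intro allI impI, elim conjE)
  fix w l assume w: "\<forall>n. w n \<in> {(\<kappa>, \<eta>). a *\<^sub>R \<eta> \<in> subdifferential h (G *v \<kappa>)}" and lim: "w \<longlonglongrightarrow> l"
  have "(\<lambda>n. a *\<^sub>R snd (w n)) \<longlonglongrightarrow> a *\<^sub>R snd l"
    by (intro tendsto_intros lim)
  moreover have "(\<lambda>n. G *v fst (w n)) \<longlonglongrightarrow> G *v fst l"
    by (intro bounded_linear.tendsto[OF matrix_vector_mul_bounded_linear] tendsto_fst lim)
  moreover have "a *\<^sub>R snd (w n) \<in> subdifferential h (G *v fst (w n))" for n
    using w by (auto simp: case_prod_beta)
  ultimately have "a *\<^sub>R snd l \<in> subdifferential h (G *v fst l)"
    by (rule subdifferential_closed[OF h])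
  then show "l \<in> {(\<kappa>, \<eta>). a *\<^sub>R \<eta> \<in> subdifferential h (G *v \<kappa>)}"
    by (simp add: case_prod_beta)
qed

theorem proposition16:
  fixes f :: "real^'n \<Rightarrow> ereal" and g :: "real^'m \<Rightarrow> ereal"
    and M :: "real^'n^'m" and W :: "real^'m^'m"
    and \<delta> \<nu> :: "nat \<Rightarrow> real" and d z p :: "nat \<Rightarrow> real^'m"
    and x xdot :: "nat \<Rightarrow> real^'n" and c :: real
  assumes "closed_proper_convex f" and "closed_proper_convex g"
    and "symmetric_pos_def W"
    and "\<And>k. 0 \<le> \<delta> k" and "summable \<delta>"
    and "summable (\<lambda>k. norm (d k))"
    and "(INF k. ereal (\<nu> k)) > 0" and "(SUP k. ereal (\<nu> k)) < 2"
    and "c > 0"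
    and "\<And>k. minimizes
           (\<lambda>u. f u + ereal (p k \<bullet> (M *v u))
                 + ereal (c / 2 * (weighted_norm W (M *v u - z k))\<^sup>2))
           (xdot (Suc k))"
    and "\<And>k. norm (M *v x (Suc k) - M *v xdot (Suc k)) \<le> \<delta> k"
    and "\<And>k. \<exists>v. minimizes
           (\<lambda>u. g u - ereal (p k \<bullet> u)
                 + ereal (c / 2 * (weighted_norm W
                     (\<nu> k *\<^sub>R (M *v x (Suc k)) + (1 - \<nu> k) *\<^sub>R z k - u))\<^sup>2)) v
           \<and> z (Suc k) = v + d k"
    and "\<And>k. p (Suc k) = p k + c *\<^sub>R
           (W *v (\<nu> k *\<^sub>R (M *v x (Suc k)) + (1 - \<nu> k) *\<^sub>R z k - z (Suc k)))"
  shows "(strong_duality f g M \<longrightarrow>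
            (\<exists>pstar zstar.
               p \<longlonglongrightarrow> pstar \<and> minimizes (dual_objective f g M) pstar \<and>
               z \<longlonglongrightarrow> zstar \<and> (\<lambda>k. M *v x (Suc k)) \<longlonglongrightarrow> zstar \<and>
               zstar \<in> subdifferential (convex_conjugate g) pstar \<and>
               - zstar \<in> subdifferential
                   (convex_conjugate f \<circ> (\<lambda>q. - (transpose M *v q))) pstar \<and>
               (rel_interior (\<Union>u. subdifferential f u) \<inter> range (\<lambda>q. transpose M *v q) \<noteq> {}
                 \<longrightarrow> (\<exists>xstar. minimizes (primal_objective f g M) xstar \<and> zstar = M *v xstar))))
       \<and> ((\<nexists>q. minimizes (dual_objective f g M) q) \<and>
           (\<exists>pbar. \<bar>dual_objective f g M pbar\<bar> \<noteq> \<infinity>) \<longrightarrow>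
            \<not> bounded (range p) \<or> \<not> bounded (range z))"
proof -
  note f = assms(1) and g = assms(2) and W = assms(3) and xstep = assms(10) and zstep = assms(12)
    and pstep = assms(13)
  define G where "G = c *\<^sub>R W"
  have G: "symmetric_pos_def G"
    unfolding G_def by (rule symmetric_pos_def_scaleR[OF W assms(9)])
  have G_mult: "c *\<^sub>R (W *v a) = G *v a" for a
    by (simp add: G_def scaleR_matrix_vector_assoc)
  obtain H where H: "symmetric_pos_def H" and GH: "\<And>a. G *v (H *v a) = a"
    and HG: "\<And>a. H *v (G *v a) = a"
    using symmetric_pos_def_inverse[OF G] by metis
  define L where "L = (\<lambda>q. - (transpose M *v q))"
  define \<phi> where "\<phi> = convex_conjugate f \<circ> L"
  define \<psi> where "\<psi> = convex_conjugate g"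
  have L: "linear L"
    unfolding L_def by (intro linear_compose_neg matrix_vector_mul_linear)
  have x_sub: "L (p k + G *v (M *v xdot (Suc k) - z k)) \<in> subdifferential f (xdot (Suc k))" for k
    unfolding L_def G_mult[symmetric] by (rule x_step_subgradient[OF f W xstep])
  have z_sub: "p (Suc k) + G *v d k \<in> subdifferential g (z (Suc k) - d k)" for k
  proof -
    let ?a = "\<nu> k *\<^sub>R (M *v x (Suc k)) + (1 - \<nu> k) *\<^sub>R z k"
    obtain v where v: "minimizes (\<lambda>u. g u - ereal (p k \<bullet> u) + ereal (c / 2 * (weighted_norm W (?a - u))\<^sup>2)) v"
      "z (Suc k) = v + d k"
      using zstep[of k] by blast
    \<comment> \<open>The update uses the perturbed z (Suc k) instead of the exact minimizer
      \<open>v\<close>, which shifts the multiplier by G d.\<close>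
    have "p k + c *\<^sub>R (W *v (?a - v)) = p (Suc k) + G *v d k"
      unfolding pstep G_mult v(2) by (simp add: matrix_vector_mult_diff_distrib matrix_vector_right_distrib)
    then show ?thesis
      using z_step_subgradient[OF g W v(1)] v(2) by simp
  qed
  obtain xf xg where nm: "\<And>a. f a \<noteq> -\<infinity>" "\<And>a. g a \<noteq> -\<infinity>" and pr: "f xf \<noteq> \<infinity>" "g xg \<noteq> \<infinity>"
    using f g by (auto simp: closed_proper_convex_def)
  \<comment> \<open>Properness comes from the first x-step: its minimizer has a subgradient in the
    range of \<open>L\<close>, and the conjugate is finite there.\<close>
  have \<phi>: "closed_proper_convex \<phi>"
    unfolding \<phi>_def
    by (rule closed_proper_convex_conjugate_comp[OF nm(1) pr(1) L subdifferential_conjugate(2)[OF f x_sub[of 0]]])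
  have conj_f: "closed_proper_convex (convex_conjugate f)"
    using closed_proper_convex_conjugate_comp[of f _ id, OF nm(1) pr(1) linear_id]
      subdifferential_conjugate(2)[OF f x_sub[of 0]] by simp
  have \<psi>: "closed_proper_convex \<psi>"
    using closed_proper_convex_conjugate_comp[of g _ id, OF nm(2) pr(2) linear_id]
      subdifferential_conjugate(2)[OF g z_sub[of 0]] by (simp add: \<psi>_def)
  \<comment> \<open>The factors -1 and 1 match the common shape of
    \<open>closed_subdifferential_relation\<close>.\<close>
  define A where "A = {(\<kappa>, \<eta>). (- 1) *\<^sub>R \<eta> \<in> subdifferential \<phi> (G *v \<kappa>)}"
  define B where "B = {(\<pi>, \<zeta>). 1 *\<^sub>R \<zeta> \<in> subdifferential \<psi> (G *v \<pi>)}"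
  \<comment> \<open>The shift by one matters: \<open>p 0\<close> and \<open>z 0\<close> are
    arbitrary, and a B-pair is available only after the first update.\<close>
  define P where "P k = H *v p (Suc k)" for k
  interpret ip: inner_form "\<lambda>u v. u \<bullet> (G *v v)"
    by (rule inner_form_matrix[OF G])
  obtain \<Lambda> where \<Lambda>: "\<Lambda> > 0" "\<And>u. ip.N u \<le> \<Lambda> * norm u"
    using ip.N_upper by blast
  obtain \<nu>min where \<nu>min': "0 < ereal \<nu>min" "ereal \<nu>min < (INF k. ereal (\<nu> k))"
    using ereal_dense2[OF assms(7)] by blast
  then have \<nu>min: "0 < \<nu>min" "\<nu>min \<le> \<nu> k" for k
    using less_INF_D[OF \<nu>min'(2), of k] by simp_all
  obtain \<nu>max where \<nu>max': "(SUP k. ereal (\<nu> k)) < ereal \<nu>max" "ereal \<nu>max < 2"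
    using ereal_dense2[OF assms(8)] by blast
  then have \<nu>max: "\<nu>max < 2" "\<nu> k \<le> \<nu>max" for k
    using SUP_lessD[OF \<nu>max'(1), of k] by simp_all
  \<comment> \<open>The error \<open>d k\<close> stays unshifted because it belongs to
    \<open>z (Suc k)\<close>, whereas the next x-step and its relaxation carry the index Suc
    k.\<close>
  interpret DR: inexact_splitting "\<lambda>u v. u \<bullet> (G *v v)" A B P "\<lambda>k. z (Suc k)"
    "\<lambda>k. M *v xdot (Suc (Suc k))" "\<lambda>k. M *v x (Suc (Suc k))" d "\<lambda>k. \<nu> (Suc k)" \<nu>min \<nu>max
  proof
    show "0 \<le> (\<pi> - \<pi>') \<bullet> (G *v (\<zeta> - \<zeta>'))" if "(\<pi>, \<zeta>) \<in> B" "(\<pi>', \<zeta>') \<in> B" for \<pi> \<zeta> \<pi>' \<zeta>'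
      using subdifferential_monotone[OF _ _ \<psi>, of \<zeta> "G *v \<pi>" \<zeta>' "G *v \<pi>'"] that
        symmetric_pos_def_swap[OF G, of "\<pi> - \<pi>'" "\<zeta> - \<zeta>'"]
      by (simp add: B_def matrix_vector_mult_diff_distrib inner_commute)
    show "(\<kappa> - \<kappa>') \<bullet> (G *v (\<eta> - \<eta>')) \<le> 0" if "(\<kappa>, \<eta>) \<in> A" "(\<kappa>', \<eta>') \<in> A" for \<kappa> \<eta> \<kappa>' \<eta>'
    proof -
      have "0 \<le> (- \<eta> - - \<eta>') \<bullet> (G *v \<kappa> - G *v \<kappa>')"
        by (rule subdifferential_monotone[OF _ _ \<phi>]) (use that in \<open>simp_all add: A_def\<close>)
      also have "\<dots> = - ((G *v (\<kappa> - \<kappa>')) \<bullet> (\<eta> - \<eta>'))"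
        by (simp add: matrix_vector_mult_diff_distrib inner_diff_left inner_diff_right inner_commute)
      finally show ?thesis
        using symmetric_pos_def_swap[OF G, of "\<kappa> - \<kappa>'" "\<eta> - \<eta>'"] by simp
    qed
    show "closed A" "closed B"
      unfolding A_def B_def by (rule closed_subdifferential_relation[OF \<phi>] closed_subdifferential_relation[OF \<psi>])+
    show "(P k + d k, z (Suc k) - d k) \<in> B" for k
      using subdifferential_conjugate(1)[OF g z_sub[of k]]
      by (simp add: B_def P_def \<psi>_def matrix_vector_right_distrib GH)
    show "(P k + (M *v xdot (Suc (Suc k)) - z (Suc k)), M *v xdot (Suc (Suc k))) \<in> A" for k
      using subdifferential_comp[OF subdifferential_conjugate(1)[OF f x_sub[of "Suc k", unfolded L_def]]]
      unfolding L_def[symmetric] \<phi>_def[symmetric]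
      by (simp add: A_def P_def matrix_vector_right_distrib GH)
    show "P (Suc k) + z (Suc (Suc k)) = P k + z (Suc k) + \<nu> (Suc k) *\<^sub>R (M *v x (Suc (Suc k)) - z (Suc k))" for k
      unfolding P_def pstep[of "Suc k"] G_mult by (simp add: matrix_vector_right_distrib HG algebra_simps)
    show "0 < \<nu>min" "\<nu>min \<le> \<nu> (Suc k)" "\<nu> (Suc k) \<le> \<nu>max" "\<nu>max < 2" for k
      using \<nu>min \<nu>max by auto
    show "summable (\<lambda>k. ip.N (d k))"
      by (rule summable_comparison_test'[OF summable_mult[OF assms(6), of \<Lambda>], of 0]) (use \<Lambda> in simp)
    have "summable (\<lambda>k. \<Lambda> * \<delta> (Suc k))"
      using assms(5) by (intro summable_mult) (simp add: summable_Suc_iff)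
    then show "summable (\<lambda>k. ip.N (M *v x (Suc (Suc k)) - M *v xdot (Suc (Suc k))))"
    proof (rule summable_comparison_test'[of _ 0])
      fix k
      have "ip.N (M *v x (Suc (Suc k)) - M *v xdot (Suc (Suc k))) \<le> \<Lambda> * \<delta> (Suc k)"
        using \<Lambda>(2)[of "M *v x (Suc (Suc k)) - M *v xdot (Suc (Suc k))"] mult_left_mono[OF assms(11)[of "Suc k"], of \<Lambda>] \<Lambda>(1)
        by linarith
      then show "norm (ip.N (M *v x (Suc (Suc k)) - M *v xdot (Suc (Suc k)))) \<le> \<Lambda> * \<delta> (Suc k)"
        by simp
    qed
  qed
  have dual: "minimizes (dual_objective f g M) (G *v \<pi>)" "\<zeta> \<in> subdifferential (convex_conjugate g) (G *v \<pi>)"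
      "- \<zeta> \<in> subdifferential (convex_conjugate f \<circ> (\<lambda>q. - (transpose M *v q))) (G *v \<pi>)"
    if "(\<pi>, \<zeta>) \<in> A" "(\<pi>, \<zeta>) \<in> B" for \<pi> \<zeta>
  proof -
    show B': "\<zeta> \<in> subdifferential (convex_conjugate g) (G *v \<pi>)"
      using that(2) by (simp add: B_def \<psi>_def)
    show A': "- \<zeta> \<in> subdifferential (convex_conjugate f \<circ> (\<lambda>q. - (transpose M *v q))) (G *v \<pi>)"
      using that(1) unfolding L_def[symmetric] \<phi>_def[symmetric] by (simp add: A_def)
    show "minimizes (dual_objective f g M) (G *v \<pi>)"
      by (rule minimizes_dual_objective[OF B' A'])
  qed
  show ?thesis
  proof (intro conjI impI)
    assume "strong_duality f g M"
    then obtain x0 p0 where x0: "x0 \<in> subdifferential (convex_conjugate f) (- (transpose M *v p0))"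
      "M *v x0 \<in> subdifferential (convex_conjugate g) p0"
      using strong_duality_subgradients[OF f g] by metis
    have "(H *v p0, M *v x0) \<in> B"
      using x0(2) by (simp add: B_def \<psi>_def GH)
    moreover have "(H *v p0, M *v x0) \<in> A"
      using subdifferential_comp[OF x0(1)] unfolding L_def[symmetric] \<phi>_def[symmetric]
      by (simp add: A_def GH)
    ultimately obtain p' z' where lim: "P \<longlonglongrightarrow> p'" "(\<lambda>k. z (Suc k)) \<longlonglongrightarrow> z'"
      "(\<lambda>k. M *v x (Suc (Suc k))) \<longlonglongrightarrow> z'" and AB: "(p', z') \<in> A" "(p', z') \<in> B"
      using DR.convergence by metis
    have "(\<lambda>k. G *v P k) \<longlonglongrightarrow> G *v p'"
      by (intro bounded_linear.tendsto[OF matrix_vector_mul_bounded_linear] lim)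
    then have "(\<lambda>k. p (Suc k)) \<longlonglongrightarrow> G *v p'"
      by (simp add: P_def GH)
    then have p_lim: "p \<longlonglongrightarrow> G *v p'"
      by (rule LIMSEQ_imp_Suc)
    have z_lim: "z \<longlonglongrightarrow> z'"
      using lim(2) by (rule LIMSEQ_imp_Suc)
    have x_lim: "(\<lambda>k. M *v x (Suc k)) \<longlonglongrightarrow> z'"
      using LIMSEQ_imp_Suc[of "\<lambda>k. M *v x (Suc k)"] lim(3) by blast
    have "\<exists>xstar. minimizes (primal_objective f g M) xstar \<and> z' = M *v xstar"
      if ri: "rel_interior (\<Union>u. subdifferential f u) \<inter> range (\<lambda>q. transpose M *v q) \<noteq> {}"
    proof -
      obtain xs where xs: "z' = M *v xs" "- (transpose M *v (G *v p')) \<in> subdifferential f xs"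
        using subdifferential_conjugate_comp[OF f conj_f dual(3)[OF AB] ri] by blast
      moreover have "G *v p' \<in> subdifferential g (M *v xs)"
        using dual(2)[OF AB] xs(1) subdifferential_conjugate_iff[OF g] by blast
      ultimately show ?thesis
        using minimizes_primal_objective by blast
    qed
    then show "\<exists>pstar zstar.
               p \<longlonglongrightarrow> pstar \<and> minimizes (dual_objective f g M) pstar \<and>
               z \<longlonglongrightarrow> zstar \<and> (\<lambda>k. M *v x (Suc k)) \<longlonglongrightarrow> zstar \<and>
               zstar \<in> subdifferential (convex_conjugate g) pstar \<and>
               - zstar \<in> subdifferential
                   (convex_conjugate f \<circ> (\<lambda>q. - (transpose M *v q))) pstar \<and>
               (rel_interior (\<Union>u. subdifferential f u) \<inter> range (\<lambda>q. transpose M *v q) \<noteq> {}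
                 \<longrightarrow> (\<exists>xstar. minimizes (primal_objective f g M) xstar \<and> zstar = M *v xstar))"
      using p_lim z_lim x_lim dual[OF AB] by blast
  next
    assume no: "(\<nexists>q. minimizes (dual_objective f g M) q) \<and>
      (\<exists>pbar. \<bar>dual_objective f g M pbar\<bar> \<noteq> \<infinity>)"
    show "\<not> bounded (range p) \<or> \<not> bounded (range z)"
    proof (rule ccontr)
      assume "\<not> (\<not> bounded (range p) \<or> \<not> bounded (range z))"
      then have bp: "bounded (range p)" and bz: "bounded (range z)"
        by auto
      have "bounded ((\<lambda>a. H *v a) ` range p)"
        by (rule bounded_linear_image[OF bp matrix_vector_mul_bounded_linear])
      then have bP: "bounded (range P)"
        by (rule bounded_subset) (auto simp: P_def)
      have bz': "bounded (range (\<lambda>k. z (Suc k)))"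
        by (rule bounded_subset[OF bz]) auto
      have "\<exists>\<pi> \<zeta>. (\<pi>, \<zeta>) \<in> B \<and> \<pi> + \<zeta> = s" for s
      proof -
        \<comment> \<open>In the dual variable q = G \<pi> the G-metric becomes the metric of H, and
          H(G s - q) = s - \<pi> is the required second component.\<close>
        obtain q where "H *v (G *v s - q) \<in> subdifferential \<psi> q"
          using resolvent_exists[OF \<psi> H] by blast
        then have "(H *v q, s - H *v q) \<in> B"
          by (simp add: B_def GH HG matrix_vector_mult_diff_distrib)
        then show ?thesis
          by (metis add_diff_cancel_left' diff_add_cancel add.commute)
      qed
      moreover have "\<exists>\<kappa> \<eta>. (\<kappa>, \<eta>) \<in> A \<and> \<kappa> - \<eta> = t" for t
      proof -
        obtain q where "H *v (G *v t - q) \<in> subdifferential \<phi> q"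
          using resolvent_exists[OF \<phi> H] by blast
        then have "(H *v q, H *v q - t) \<in> A"
          by (simp add: A_def GH HG matrix_vector_mult_diff_distrib)
        then show ?thesis
          by (metis diff_diff_eq2 add_diff_cancel_left')
      qed
      ultimately obtain \<pi> \<zeta> where "(\<pi>, \<zeta>) \<in> A" "(\<pi>, \<zeta>) \<in> B"
        using DR.zero_exists_if_bounded[OF bP bz'] by blast
      then show False
        using dual(1) no by blast
    qed
  qed
qed

end
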